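(* Let $d\ge 2$ and let $(X,\mu)$ be a $\sigma$-finite non-atomic standard measure space with $\mu(X)=\infty$. Then the subset $\mathcal V$ of all $\mathbb Z^d$-actions $T\in\mathcal A^{\mathbb Z^d}_\mu$ on $(X,\mu)$ with $\mathcal R(T)=P(\mathbb R^d)$ is residual in $\mathcal A_\mu^{\mathbb Z^d}$ (i.e. it contains a dense $G_\delta$-subset).
   Context: $P(\mathbb R^d)$ is the set of lines (1-dimensional linear subspaces) in $\mathbb R^d$; $\mathrm{dist}$ is the Euclidean distance on $\mathbb R^d$. $\mathrm{Aut}(X,\mu)$ is the group of all $\mu$-preserving invertible transformations of $X$ (mod 0) with the weak topology: $R_n\to R$ iff $\mu(R_nA\,\triangle\,RA)\to0$ and $\mu(R_n^{-1}A\,\triangle\,R^{-1}A)\to 0$ for every measurable $A$ with $\mu(A)<\infty$; this is a Polish group. $\mathcal A^{\mathbb Z^d}_\mu$ is the set of all $\mu$-preserving actions of $\mathbb Z^d$ on $(X,\mu)$, viewed as homomorphisms $\gamma\mapsto T_\gamma$ from $\mathbb Z^d$ to $\mathrm{Aut}(X,\mu)$, with the compact-open topology (i.e. $T^{(n)}\to T$ iff $T^{(n)}_\gamma\to T_\gamma$ weakly for each $\gamma\in\mathbb Z^d$); it is a Polish space. $T$ is recurrent along a line $\theta\in P(\mathbb R^d)$ if for each $\epsilon>0$ and each measurable $A$ with $\mu(A)>0$ there are $\gamma\in\mathbb Z^d\setminus\{0\}$ and $g\in\theta$ such that $\mathrm{dist}(\gamma,g)<\epsilon$ and $\mu(A\cap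 T_\gamma A)>0$. $\mathcal R(T)$ is the set of all $\theta\in P(\mathbb R^d)$ such that $T$ is recurrent along $\theta$. *)

theory Defs
  imports "HOL-Analysis.Analysis" "HOL-Algebra.Group"
begin

section \<open>Standard non-atomic measure spaces\<close>

definition standard_borel :: "'a measure \<Rightarrow> bool" where
  "standard_borel M \<longleftrightarrow>
     (\<exists>X. topspace X = space M \<and> completely_metrizable_space X \<and> second_countable X \<and>
          sets M = sigma_sets (space M) {U. openin X U})"

definition nonatomic :: "'a measure \<Rightarrow> bool" where
  "nonatomic M \<longleftrightarrow>
     (\<forall>A\<in>sets M. 0 < emeasure M A \<longrightarrow>
        (\<exists>B\<in>sets M. B \<subseteq> A \<and> 0 < emeasure M B \<and> emeasure M B < emeasure M A))"


section \<open>The group of measure-preserving transformations mod 0\<close>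

text \<open>Representatives: measurable measure-preserving maps with a measurable inverse mod 0.
  The inverse then preserves the measure as well, see \<open>transf_inverse\<close>.\<close>

definition transf :: "'a measure \<Rightarrow> ('a \<Rightarrow> 'a) set" where
  "transf M = {f \<in> measurable M M. distr M M f = M \<and>
     (\<exists>g\<in>measurable M M. (AE x in M. g (f x) = x) \<and> (AE x in M. f (g x) = x))}"

definition transf_class :: "'a measure \<Rightarrow> ('a \<Rightarrow> 'a) \<Rightarrow> ('a \<Rightarrow> 'a) set" where
  "transf_class M f = {h \<in> transf M. AE x in M. h x = f x}"

definition aut_group :: "'a measure \<Rightarrow> ('a \<Rightarrow> 'a) set monoid" where
  "aut_group M =
     \<lparr>carrier = transf_class M ` transf M,
      mult = (\<lambda>R S. transf_class M ((SOME f. f \<in> R) \<circ> (SOME g. g \<in> S))),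
      one = transf_class M id\<rparr>"

text \<open>The image \<open>R A\<close> of a measurable set is only defined mod 0.  It is taken as the preimage of
  \<open>A\<close> under a representative of the inverse class, because the set-theoretic image under a
  representative that is merely invertible mod 0 need not be measurable.\<close>

definition aut_image :: "'a measure \<Rightarrow> ('a \<Rightarrow> 'a) set \<Rightarrow> 'a set \<Rightarrow> 'a set" where
  "aut_image M R A = (SOME g. g \<in> inv\<^bsub>aut_group M\<^esub> R) -` A \<inter> space M"

text \<open>The topology generated by the balls of the pseudometrics
  \<open>\<mu>(R A \<triangle> S A)\<close> and \<open>\<mu>(R\<^sup>-\<^sup>1 A \<triangle> S\<^sup>-\<^sup>1 A)\<close> with \<open>\<mu>(A) < \<infinity>\<close>; its convergent sequences
  are identified in \<open>limitin_weak_topology\<close>.\<close>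

definition weak_topology :: "'a measure \<Rightarrow> ('a \<Rightarrow> 'a) set topology" where
  "weak_topology M = topology_generated_by
     ({{S \<in> carrier (aut_group M).
          emeasure M (sym_diff (aut_image M S A) (aut_image M R A)) < ennreal e} | R A e.
        R \<in> carrier (aut_group M) \<and> A \<in> sets M \<and> emeasure M A < \<infinity> \<and> e > 0} \<union>
      {{S \<in> carrier (aut_group M).
          emeasure M (sym_diff (aut_image M (inv\<^bsub>aut_group M\<^esub> S) A)
                               (aut_image M (inv\<^bsub>aut_group M\<^esub> R) A)) < ennreal e} | R A e.
        R \<in> carrier (aut_group M) \<and> A \<in> sets M \<and> emeasure M A < \<infinity> \<and> e > 0})"


section \<open>Actions of the integer lattice\<close>

definition lattice_group :: "(int ^ 'n) monoid" where
  "lattice_group = \<lparr>carrier = UNIV, mult = (+), one = 0\<rparr>"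

definition actions :: "'a measure \<Rightarrow> (int ^ 'n \<Rightarrow> ('a \<Rightarrow> 'a) set) set" where
  "actions M = hom lattice_group (aut_group M)"

text \<open>The lattice is discrete, so the compact-open topology is that of pointwise convergence.\<close>

definition action_topology :: "'a measure \<Rightarrow> (int ^ 'n \<Rightarrow> ('a \<Rightarrow> 'a) set) topology" where
  "action_topology M = subtopology (product_topology (\<lambda>_. weak_topology M) UNIV) (actions M)"

definition residual_in :: "'b topology \<Rightarrow> 'b set \<Rightarrow> bool" where
  "residual_in X V \<longleftrightarrow>
     V \<subseteq> topspace X \<and> (\<exists>G. gdelta_in X G \<and> X closure_of G = topspace X \<and> G \<subseteq> V)"


section \<open>Recurrence along lines\<close>

definition lines :: "(real ^ 'n) set set" where
  "lines = {\<theta>. subspace \<theta> \<and> dim \<theta> = 1}"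

definition lattice_point :: "int ^ 'n \<Rightarrow> real ^ 'n" where
  "lattice_point \<gamma> = (\<chi> i. real_of_int (\<gamma> $ i))"

definition recurrent_along ::
    "'a measure \<Rightarrow> (int ^ 'n \<Rightarrow> ('a \<Rightarrow> 'a) set) \<Rightarrow> (real ^ 'n) set \<Rightarrow> bool" where
  "recurrent_along M T \<theta> \<longleftrightarrow>
     (\<forall>e>0. \<forall>A\<in>sets M. 0 < emeasure M A \<longrightarrow>
        (\<exists>\<gamma>. \<gamma> \<noteq> 0 \<and> (\<exists>g\<in>\<theta>. dist (lattice_point \<gamma>) g < e) \<and>
             0 < emeasure M (A \<inter> aut_image M (T \<gamma>) A)))"

definition recurrent_lines ::
    "'a measure \<Rightarrow> (int ^ 'n \<Rightarrow> ('a \<Rightarrow> 'a) set) \<Rightarrow> (real ^ 'n) set set" where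
  "recurrent_lines M T = {\<theta> \<in> lines. recurrent_along M T \<theta>}"


section \<open>Well-definedness\<close>

lemma transf_measurable: "f \<in> transf M \<Longrightarrow> f \<in> measurable M M"
  by (simp add: transf_def)

lemma transf_AE:
  assumes "f \<in> transf M" "AE x in M. P x"
  shows "AE x in M. P (f x)"
proof -
  have "distr M M f = M" and "f \<in> measurable M M" using assms(1) by (auto simp: transf_def)
  moreover from this(1) have "AE x in distr M M f. P x" using assms(2) by (simp only:)
  ultimately show ?thesis by (blast intro: AE_distrD)
qed

lemma transf_inverse:
  assumes f: "f \<in> transf M"
  obtains g where "g \<in> transf M" "AE x in M. g (f x) = x" "AE x in M. f (g x) = x"
proof -
  obtain g where g: "g \<in> measurable M M" "AE x in M. g (f x) = x" "AE x in M. f (g x) = x"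
    using f by (auto simp: transf_def)
  have fm: "f \<in> measurable M M" and fd: "distr M M f = M" using f by (auto simp: transf_def)
  have "distr M M g = distr (distr M M f) M g" using fd by simp
  also have "\<dots> = distr M M (g \<circ> f)" using g fm by (simp add: distr_distr)
  also have "\<dots> = distr M M (\<lambda>x. x)"
    by (rule distr_cong_AE) (use g fm in \<open>auto simp: o_def\<close>)
  finally have "distr M M g = M" by (simp add: distr_id)
  then have "g \<in> transf M" using g fm by (auto simp: transf_def)
  with g show ?thesis using that by blast
qed

lemma transf_id: "id \<in> transf M" "(\<lambda>x. x) \<in> transf M"
  by (auto simp: transf_def distr_id id_def intro!: bexI[of _ "\<lambda>x. x"])

lemma transf_comp:
  assumes f: "f \<in> transf M" and g: "g \<in> transf M"
  shows "f \<circ> g \<in> transf M"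
proof -
  obtain f' where f': "f' \<in> transf M" "AE x in M. f' (f x) = x" "AE x in M. f (f' x) = x"
    using transf_inverse[OF f] .
  obtain g' where g': "g' \<in> transf M" "AE x in M. g' (g x) = x" "AE x in M. g (g' x) = x"
    using transf_inverse[OF g] .
  have m: "f \<in> measurable M M" "g \<in> measurable M M" "f' \<in> measurable M M" "g' \<in> measurable M M"
    using f g f' g' transf_measurable by auto
  have "distr M M (f \<circ> g) = distr (distr M M g) M f" using m by (simp add: distr_distr)
  also have "\<dots> = M" using f g by (simp add: transf_def)
  finally have d: "distr M M (f \<circ> g) = M" .
  have 1: "AE x in M. (g' \<circ> f') ((f \<circ> g) x) = x"
    using transf_AE[OF g f'(2)] g'(2) by eventually_elim simp
  have 2: "AE x in M. (f \<circ> g) ((g' \<circ> f') x) = x"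
    using transf_AE[OF f'(1) g'(3)] f'(3) by eventually_elim simp
  have "g' \<circ> f' \<in> measurable M M" "f \<circ> g \<in> measurable M M" using m by auto
  with d 1 2 show ?thesis unfolding transf_def by blast
qed

lemma transf_class_self: "f \<in> transf M \<Longrightarrow> f \<in> transf_class M f"
  by (simp add: transf_class_def)

lemma transf_class_cong:
  assumes "AE x in M. f x = g x"
  shows "transf_class M f = transf_class M g"
proof -
  have "(AE x in M. h x = f x) \<longleftrightarrow> (AE x in M. h x = g x)" for h
    by (rule eventually_subst) (use assms in eventually_elim, simp)
  then show ?thesis by (simp add: transf_class_def)
qed

lemma transf_class_some:
  assumes "f \<in> transf M"
  shows "(SOME h. h \<in> transf_class M f) \<in> transf M"
    and "AE x in M. (SOME h. h \<in> transf_class M f) x = f x"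
  using someI[of "\<lambda>h. h \<in> transf_class M f", OF transf_class_self[OF assms]]
  by (auto simp: transf_class_def)

lemma aut_mult:
  assumes f: "f \<in> transf M" and g: "g \<in> transf M"
  shows "transf_class M f \<otimes>\<^bsub>aut_group M\<^esub> transf_class M g = transf_class M (f \<circ> g)"
proof -
  have "AE x in M. (SOME h. h \<in> transf_class M f) ((SOME h. h \<in> transf_class M g) x) = f (g x)"
    using transf_class_some(2)[OF g]
      transf_AE[OF transf_class_some(1)[OF g] transf_class_some(2)[OF f]]
    by eventually_elim simp
  then show ?thesis by (auto simp: aut_group_def intro!: transf_class_cong)
qed

lemma aut_one: "\<one>\<^bsub>aut_group M\<^esub> = transf_class M id"
  and aut_carrier: "carrier (aut_group M) = transf_class M ` transf M"
  by (simp_all add: aut_group_def)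

lemma group_aut_group: "group (aut_group M)"
proof (rule groupI)
  fix R assume "R \<in> carrier (aut_group M)"
  then obtain f where f: "f \<in> transf M" "R = transf_class M f" by (auto simp: aut_carrier)
  obtain g where g: "g \<in> transf M" "AE x in M. g (f x) = x" using transf_inverse[OF f(1)] .
  have "transf_class M (g \<circ> f) = transf_class M id"
    using g(2) by (intro transf_class_cong) simp
  then show "\<exists>S\<in>carrier (aut_group M). S \<otimes>\<^bsub>aut_group M\<^esub> R = \<one>\<^bsub>aut_group M\<^esub>"
    using f g(1) by (auto simp: aut_carrier aut_one aut_mult)
qed (auto simp: aut_carrier aut_one aut_mult transf_comp transf_id o_assoc)

lemma aut_inv:
  assumes "f \<in> transf M" "g \<in> transf M" "AE x in M. g (f x) = x"
  shows "inv\<^bsub>aut_group M\<^esub> (transf_class M f) = transf_class M g"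
proof -
  have "transf_class M (g \<circ> f) = transf_class M id"
    using assms(3) by (intro transf_class_cong) simp
  then show ?thesis
    using assms by (intro group.inv_equality[OF group_aut_group])
      (auto simp: aut_carrier aut_one aut_mult)
qed

lemma aut_image_AE:
  assumes "f \<in> transf M" "g \<in> transf M" "AE x in M. g (f x) = x"
  shows "AE x in M. x \<in> aut_image M (transf_class M f) A \<longleftrightarrow> g x \<in> A"
  unfolding aut_image_def aut_inv[OF assms]
  using transf_class_some(2)[OF assms(2)] AE_space by eventually_elim simp

lemma aut_image_sets:
  assumes "R \<in> carrier (aut_group M)" "A \<in> sets M"
  shows "aut_image M R A \<in> sets M"
proof -
  have "inv\<^bsub>aut_group M\<^esub> R \<in> carrier (aut_group M)"
    using group.inv_closed[OF group_aut_group assms(1)] .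
  then obtain g where "g \<in> transf M" "inv\<^bsub>aut_group M\<^esub> R = transf_class M g"
    by (auto simp: aut_carrier)
  then show ?thesis
    unfolding aut_image_def using transf_class_some(1) transf_measurable assms(2)
    by (metis measurable_sets)
qed

lemma emeasure_sym_diff_triangle:
  assumes "A \<in> sets M" "B \<in> sets M" "C \<in> sets M"
  shows "emeasure M (sym_diff A C) \<le> emeasure M (sym_diff A B) + emeasure M (sym_diff B C)"
proof -
  have "emeasure M (sym_diff A C) \<le> emeasure M (sym_diff A B \<union> sym_diff B C)"
    using assms by (intro emeasure_mono) auto
  also have "\<dots> \<le> emeasure M (sym_diff A B) + emeasure M (sym_diff B C)"
    using assms by (intro emeasure_subadditive) auto
  finally show ?thesis .
qed

lemma topspace_weak_topology: "topspace (weak_topology M) = carrier (aut_group M)"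
proof -
  have "S \<in> topspace (weak_topology M)" if S: "S \<in> carrier (aut_group M)" for S
  proof -
    let ?U = "{S' \<in> carrier (aut_group M).
          emeasure M (sym_diff (aut_image M S' {}) (aut_image M S {})) < ennreal 1}"
    have "S \<in> ?U" using S by (simp add: aut_image_def)
    moreover have "\<exists>R A e. ?U = {S \<in> carrier (aut_group M).
          emeasure M (sym_diff (aut_image M S A) (aut_image M R A)) < ennreal e} \<and>
        R \<in> carrier (aut_group M) \<and> A \<in> sets M \<and> emeasure M A < \<infinity> \<and> (0::real) < e"
      using S by (intro exI[of _ S] exI[of _ "{}"] exI[of _ "1::real"]) simp
    ultimately show ?thesis
      unfolding weak_topology_def topology_generated_by_topspace
      by (intro UnionI[OF UnI1[OF CollectI]])
  qed
  moreover have "topspace (weak_topology M) \<subseteq> carrier (aut_group M)"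
    unfolding weak_topology_def topology_generated_by_topspace
    by (intro Union_least) (elim UnE CollectE exE conjE, simp_all)
  ultimately show ?thesis by blast
qed

lemma limitin_weak_topology:
  fixes S :: "nat \<Rightarrow> ('a \<Rightarrow> 'a) set"
  assumes S: "\<And>n. S n \<in> carrier (aut_group M)" and R: "R \<in> carrier (aut_group M)"
  shows "limitin (weak_topology M) S R sequentially \<longleftrightarrow>
    (\<forall>A\<in>sets M. emeasure M A < \<infinity> \<longrightarrow>
       (\<lambda>n. emeasure M (sym_diff (aut_image M (S n) A) (aut_image M R A))) \<longlonglongrightarrow> 0 \<and>
       (\<lambda>n. emeasure M (sym_diff (aut_image M (inv\<^bsub>aut_group M\<^esub> (S n)) A)
                              (aut_image M (inv\<^bsub>aut_group M\<^esub> R) A))) \<longlonglongrightarrow> 0)"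
    (is "?L \<longleftrightarrow> ?R")
proof -
  let ?G = "carrier (aut_group M)"
  define d where "d P Q A = emeasure M (sym_diff (aut_image M P A) (aut_image M Q A))" for P Q A
  define i where "i P = inv\<^bsub>aut_group M\<^esub> P" for P
  define ball where "ball j Q A e = {P \<in> ?G. d (j P) (j Q) A < ennreal e}"
    for j :: "('a \<Rightarrow> 'a) set \<Rightarrow> ('a \<Rightarrow> 'a) set" and Q A e
  define J where "J = {(\<lambda>P. P), i}"
  define B where "B = {ball j Q A e | j Q A e. j \<in> J \<and> Q \<in> ?G \<and> A \<in> sets M \<and> emeasure M A < \<infinity> \<and> e > 0}"
  let ?ok = "\<lambda>Q A e. Q \<in> ?G \<and> A \<in> sets M \<and> emeasure M A < \<infinity> \<and> (e::real) > 0"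
  have "B = {ball (\<lambda>P. P) Q A e | Q A e. ?ok Q A e} \<union> {ball i Q A e | Q A e. ?ok Q A e}"
    unfolding B_def J_def by fast
  then have top: "weak_topology M = topology_generated_by B"
    unfolding weak_topology_def ball_def d_def i_def by simp
  have j: "j P \<in> ?G" if "j \<in> J" "P \<in> ?G" for j P
    using that group.inv_closed[OF group_aut_group] by (auto simp: J_def i_def)
  have R_eq: "?R \<longleftrightarrow> (\<forall>A\<in>sets M. emeasure M A < \<infinity> \<longrightarrow> (\<forall>j\<in>J. (\<lambda>n. d (j (S n)) (j R) A) \<longlonglongrightarrow> 0))"
    by (simp add: J_def d_def i_def)
  show ?thesis
  proof
    assume L: ?L
    show ?R unfolding R_eq
    proof (intro ballI impI)
      fix A j assume A: "A \<in> sets M" "emeasure M A < \<infinity>" and jJ: "j \<in> J"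
      show "(\<lambda>n. d (j (S n)) (j R) A) \<longlonglongrightarrow> 0"
      proof (rule order_tendstoI)
        fix a :: ennreal assume "0 < a"
        then obtain y where y: "0 < y" "y < a" using dense by blast
        then obtain e where e: "y = ennreal e" "0 < e"
          by (cases y) (auto simp: ennreal_less_zero_iff)
        have "ball j R A e \<in> B" unfolding B_def using A jJ R e by blast
        then have "openin (weak_topology M) (ball j R A e)"
          unfolding top by (rule topology_generated_by_Basis)
        moreover have "R \<in> ball j R A e" using R e by (simp add: ball_def d_def)
        ultimately have "eventually (\<lambda>n. S n \<in> ball j R A e) sequentially"
          using L unfolding limitin_def by blast
        then show "eventually (\<lambda>n. d (j (S n)) (j R) A < a) sequentially"
          by eventually_elim (use y e in \<open>auto simp: ball_def\<close>)
      qed simp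
    qed
  next
    assume ?R
    then have lim: "(\<lambda>n. d (j (S n)) (j R) A) \<longlonglongrightarrow> 0"
      if "A \<in> sets M" "emeasure M A < \<infinity>" "j \<in> J" for A j using that unfolding R_eq by blast
    have "R \<in> U \<longrightarrow> eventually (\<lambda>n. S n \<in> U) sequentially" if "generate_topology_on B U" for U
      using that
    proof induction
      case (Int a b)
      then show ?case by (auto intro: eventually_conj)
    next
      case (UN K)
      show ?case
      proof
        assume "R \<in> \<Union>K"
        then obtain k where "k \<in> K" "R \<in> k" by blast
        then have "eventually (\<lambda>n. S n \<in> k) sequentially" using UN by blast
        then show "eventually (\<lambda>n. S n \<in> \<Union>K) sequentially"
          by eventually_elim (use \<open>k \<in> K\<close> in blast)
      qed
    next
      case (Basis U)
      show ?case
      proof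
        assume RU: "R \<in> U"
        from Basis obtain j Q A e where U: "U = ball j Q A e" and jQ: "j \<in> J" "Q \<in> ?G"
          and A: "A \<in> sets M" "emeasure M A < \<infinity>" unfolding B_def by blast
        have "(\<lambda>n. d (j (S n)) (j R) A + d (j R) (j Q) A) \<longlonglongrightarrow> 0 + d (j R) (j Q) A"
          by (intro tendsto_add lim A jQ tendsto_const)
        moreover have "0 + d (j R) (j Q) A < ennreal e" using RU by (simp add: U ball_def)
        ultimately have "eventually (\<lambda>n. d (j (S n)) (j R) A + d (j R) (j Q) A < ennreal e) sequentially"
          by (rule order_tendstoD(2))
        then show "eventually (\<lambda>n. S n \<in> U) sequentially"
        proof eventually_elim
          case (elim n)
          have "d (j (S n)) (j Q) A \<le> d (j (S n)) (j R) A + d (j R) (j Q) A"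
            unfolding d_def
            using aut_image_sets[OF j[OF jQ(1) S] A(1)] aut_image_sets[OF j[OF jQ(1) R] A(1)]
              aut_image_sets[OF j[OF jQ(1) jQ(2)] A(1)] by (rule emeasure_sym_diff_triangle)
          also note elim
          finally show ?case using S by (simp add: U ball_def)
        qed
      qed
    qed simp
    then show ?L
      using R unfolding limitin_def topspace_weak_topology
      by (simp add: top openin_topology_generated_by_iff)
  qed
qed

end

theory Submission
  imports Defs "HOL-Probability.Probability" "HOL-Analysis.Kronecker_Approximation_Theorem"
begin

text \<open>Call an action periodic if all \<open>T\<^sub>\<gamma>\<close> with \<open>\<gamma> \<in> N \<int>\<^sup>d\<close> are trivial for some \<open>N > 0\<close>.  By Dirichlet's
  theorem every line passes arbitrarily close to nonzero points of \<open>N \<int>\<^sup>d\<close>, with a bound on the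
  point that is uniform in the line.  Hence the actions \<open>T\<close> such that for every \<open>k\<close> some \<open>N\<close> has
  \<open>T\<^bsub>N\<gamma>\<^esub>\<close> within \<open>1/k\<close> of the identity on the first \<open>k\<close> sets of a countable dense family, for all
  \<open>\<gamma>\<close> in a box depending on \<open>N\<close> and \<open>k\<close>, form a \<open>G\<^sub>\<delta>\<close> set of actions that are recurrent along all
  lines.  It contains the periodic actions, and these are dense: no Baire category argument is
  needed.\<close>

section \<open>Coding standard Borel spaces by reals\<close>

text \<open>The weight of the argument lies in the density of the periodic actions. An arbitrary
  action need not be free, so there is no Rokhlin tower whose ends could be joined. A basic
  neighbourhood of \<open>T\<close> sees only finitely many sets of finite measure, however, and
  their membership pattern is a label with finitely many values. Randomising the starting point by a
  uniform vector \<open>q\<close> of a large cube replaces the tower: the label of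
  \<open>T_q y\<close> has the same distribution as the label of \<open>y\<close>, provided
  \<open>y\<close> ranges over a set of finite measure that contains all relevant preimages.
  Non-atomic standard probability spaces with equally distributed labels are isomorphic by a map
  that respects labels; this is why points are coded by reals and why the isomorphism theorem
  carries labels. Cyclic translation of \<open>q\<close> is periodic by construction and can differ
  from \<open>T\<close> only where the cube wraps around. The lines are uncountably many, so
  conditions imposed line by line would not in general give a G-delta set; this forces the
  uniformity over lines.\<close>

lemma ternary_digit:
  fixes b :: "nat \<Rightarrow> bool"
  shows "\<lfloor>3 ^ n * (\<Sum>m. of_bool (b m) / 3 ^ m :: real)\<rfloor> mod 3 = of_bool (b n)"
proof -
  let ?a = "\<lambda>m. of_bool (b m) / 3 ^ m :: real"
  have geo: "summable (\<lambda>m. (1 / 3) ^ m :: real)" by (rule summable_geometric) simp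
  have le: "?a m \<le> (1 / 3) ^ m" for m by (auto simp: power_one_over)
  have sa: "summable ?a"
    by (rule summable_comparison_test'[OF geo, of 0]) (use le in \<open>auto simp: power_one_over\<close>)
  define t where "t = 3 ^ n * (\<Sum>m. ?a (m + Suc n))"
  define Z where "Z = (\<Sum>m<n. of_bool (b m) * 3 ^ (n - Suc m) :: int)"
  have "3 ^ n * (\<Sum>m<n. ?a m) = (\<Sum>m<n. of_bool (b m) * 3 ^ (n - m))"
    by (auto simp: sum_distrib_left power_diff intro!: sum.cong)
  also have "\<dots> = 3 * real_of_int Z"
    unfolding Z_def by (auto simp: sum_distrib_left Suc_diff_Suc simp flip: power_Suc intro!: sum.cong)
  finally have fin: "3 ^ n * (\<Sum>m<n. ?a m) = 3 * real_of_int Z" .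
  have "(\<Sum>m. ?a m) = (\<Sum>m. ?a (m + Suc n)) + (\<Sum>m<Suc n. ?a m)"
    by (rule suminf_split_initial_segment[OF sa])
  then have "3 ^ n * (\<Sum>m. ?a m) = t + 3 ^ n * (\<Sum>m<n. ?a m) + of_bool (b n)"
    by (simp add: t_def algebra_simps)
  then have eq: "3 ^ n * (\<Sum>m. ?a m) = t + of_int (3 * Z + of_bool (b n))"
    using fin by simp
  have sa': "summable (\<lambda>m. ?a (m + Suc n))"
    using sa by (subst summable_iff_shift)
  have t0: "0 \<le> t" unfolding t_def by (intro mult_nonneg_nonneg suminf_nonneg sa') auto
  \<comment> \<open>Digits 0 and 1 in base 3 leave at most 1/2 after position \<open>n\<close>, so
    the tail cannot disturb the floor; in base 2 it could reach 1.\<close>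
  have "(\<lambda>m. (1 / 3) ^ (m + Suc n) :: real) sums ((1 / 3) ^ Suc n * (1 / (1 - 1 / 3)))"
    using sums_mult[OF geometric_sums[of "1 / 3 :: real"], of "(1/3) ^ Suc n"]
    by (simp add: power_add mult_ac)
  then have "(\<Sum>m. ?a (m + Suc n)) \<le> (1 / 3) ^ Suc n * (1 / (1 - 1 / 3))"
    by (rule sums_le[OF le summable_sums[OF sa']])
  then have "t \<le> 3 ^ n * ((1 / 3) ^ Suc n * (1 / (1 - 1 / 3)))"
    unfolding t_def by (intro mult_left_mono) auto
  also have "\<dots> < 1" by (simp add: power_one_over)
  finally have "\<lfloor>3 ^ n * (\<Sum>m. ?a m)\<rfloor> = 3 * Z + of_bool (b n)"
    unfolding eq using t0 by (intro floor_unique) auto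
  then show ?thesis by (auto simp: mod_add_eq)
qed

text \<open>A point is coded by the real whose ternary digits record its distances to a dense sequence
  up to dyadic errors; it is decoded as the limit of its approximations from that sequence.\<close>

lemma standard_borel_code:
  assumes "standard_borel M" "space M \<noteq> {}"
  obtains f :: "'a \<Rightarrow> real" and g
  where "f \<in> borel_measurable M" "g \<in> measurable borel M" "\<And>x. x \<in> space M \<Longrightarrow> g (f x) = x"
proof -
  obtain X where X: "topspace X = space M" "completely_metrizable_space X" "second_countable X"
    and sM: "sets M = sigma_sets (space M) {U. openin X U}"
    using assms(1) by (auto simp: standard_borel_def)
  obtain S d where S: "Metric_space S d" "Metric_space.mcomplete S d" "X = Metric_space.mtopology S d"
    using X(2) by (auto simp: completely_metrizable_space_def)
  interpret Metric_space S d by fact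
  have [simp]: "space M = S" using X(1) S(3) by simp
  have open_sets: "U \<in> sets M" if "openin X U" for U
    using that by (auto simp: sM)
  obtain C where C: "countable C" "C \<subseteq> S" "X closure_of C = S"
    using second_countable_imp_separable_space[OF X(3)] by (auto simp: separable_space_def S(3))
  have "C \<noteq> {}" using C(3) assms(2) by auto
  define s where "s = from_nat_into C"
  have sS: "s i \<in> S" for i using from_nat_into[OF \<open>C \<noteq> {}\<close>] C(2) by (auto simp: s_def)
  have dense: "\<exists>i. d (s i) x < e" if "x \<in> S" "e > 0" for x e
  proof -
    have "\<forall>r>0. \<exists>y\<in>C. y \<in> mball x r"
      using that(1) C(3) unfolding S(3) metric_closure_of by blast
    then have "\<exists>y\<in>C. y \<in> mball x e" using that(2) by blast
    then obtain y where y: "y \<in> C" "d x y < e" by auto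
    then obtain i where "s i = y" using from_nat_into_surj[OF C(1)] unfolding s_def by blast
    then show ?thesis using y by (metis commute)
  qed
  \<comment> \<open>A digit position codes a pair: the precision \<open>j\<close> first, the index
    \<open>i\<close> in the dense sequence second. From the digits alone, \<open>c\<close> below
    finds the first index that is good at precision \<open>j\<close>.\<close>
  define bit where "bit n x \<longleftrightarrow> d (s (snd (prod_decode n))) x < 1 / 2 ^ fst (prod_decode n)" for n x
  define f where "f x = (\<Sum>n. of_bool (bit n x) / 3 ^ n :: real)" for x
  define c where "c y j = (LEAST i. \<lfloor>3 ^ prod_encode (j, i) * y\<rfloor> mod 3 = 1)" for y :: real and j
  define \<sigma> where "\<sigma> y j = s (c y j)" for y j
  \<comment> \<open>Not every real is a code. The default \<open>s 0\<close> keeps \<open>g\<close>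
    a total map into the space; in the Cauchy case completeness supplies the limit.\<close>
  define g where "g y = (if MCauchy (\<sigma> y) then SOME l. limitin mtopology (\<sigma> y) l sequentially else s 0)" for y
  have lim: "limitin mtopology (\<sigma> y) (g y) sequentially" if "MCauchy (\<sigma> y)" for y
    using that S(2) unfolding g_def mcomplete_def by (auto intro: someI_ex)
  have near: "\<forall>\<^sub>F j in sequentially. d (\<sigma> y j) (g y) < e" if "MCauchy (\<sigma> y)" "e > 0" for y e
  proof -
    have "\<forall>\<^sub>F j in sequentially. \<sigma> y j \<in> S \<and> d (\<sigma> y j) (g y) < e"
      using lim[OF that(1)] that(2) unfolding limitin_metric by blast
    then show ?thesis by eventually_elim blast
  qed
  have gS: "g y \<in> S" for y
    using lim[of y] limitin_mspace sS[of 0] by (cases "MCauchy (\<sigma> y)") (blast, simp add: g_def)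
  have gf: "g (f x) = x" if x: "x \<in> S" for x
  proof -
    have "c (f x) j = (LEAST i. bit (prod_encode (j, i)) x)" for j
      unfolding c_def f_def ternary_digit by simp
    moreover have "\<exists>i. bit (prod_encode (j, i)) x" for j
      using dense[OF x, of "1 / 2 ^ j"] by (auto simp: bit_def)
    ultimately have "bit (prod_encode (j, c (f x) j)) x" for j
      by (metis LeastI_ex)
    then have close: "d (\<sigma> (f x) j) x < (1 / 2) ^ j" for j by (simp add: bit_def \<sigma>_def power_one_over)
    have "limitin mtopology (\<sigma> (f x)) x sequentially"
      unfolding limitin_metric
    proof (intro conjI x allI impI)
      fix e :: real assume "e > 0"
      have "(\<lambda>j. (1 / 2 :: real) ^ j) \<longlonglongrightarrow> 0" by (rule LIMSEQ_realpow_zero) auto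
      then have "\<forall>\<^sub>F j in sequentially. (1 / 2) ^ j < e" using \<open>e > 0\<close> by (rule order_tendstoD)
      then show "\<forall>\<^sub>F j in sequentially. \<sigma> (f x) j \<in> S \<and> d (\<sigma> (f x) j) x < e"
        by eventually_elim (use close sS in \<open>auto simp: \<sigma>_def intro: less_trans\<close>)
    qed
    moreover from this have "MCauchy (\<sigma> (f x))"
      by (rule convergent_imp_MCauchy[rotated]) (use sS in \<open>auto simp: \<sigma>_def\<close>)
    ultimately show ?thesis using lim limitin_metric_unique trivial_limit_sequentially by blast
  qed
  have [measurable]: "Measurable.pred M (bit n)" for n
  proof -
    have "{x \<in> space M. bit n x} = mball (s (snd (prod_decode n))) (1 / 2 ^ fst (prod_decode n))"
      using sS by (auto simp: bit_def)
    then show ?thesis using open_sets openin_mball by (auto simp: pred_def S(3))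
  qed
  have fm: "f \<in> borel_measurable M" unfolding f_def by measurable
  have cm [measurable]: "(\<lambda>y. c y j) \<in> measurable borel (count_space UNIV)" for j
    unfolding c_def by measurable
  \<comment> \<open>The indices take countably many values, so an arbitrary predicate of two of them
    is measurable.\<close>
  have pm: "Measurable.pred borel (\<lambda>y. P (c y i) (c y j))" for P i j
    by (rule measurable_compose_countable[OF _ cm[of i]], rule measurable_compose_countable[OF _ cm[of j]]) simp
  have [measurable]: "Measurable.pred borel (\<lambda>y. d (s (c y i)) (s (c y j)) < e)" for i j e
    by (rule pm)
  \<comment> \<open>Tolerances \<open>1 / Suc k\<close> leave only countable quantifiers, which
    makes the Cauchy condition measurable in \<open>y\<close>.\<close>
  have "MCauchy (\<sigma> y) \<longleftrightarrow> (\<forall>k::nat. \<exists>N. \<forall>n n'. N \<le> n \<longrightarrow> N \<le> n' \<longrightarrow> d (s (c y n)) (s (c y n')) < 1 / Suc k)" for y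
  proof -
    have archimedean: "(\<forall>e>0. P e) \<longleftrightarrow> (\<forall>k::nat. P (1 / real (Suc k)))"
      if mono: "\<And>e e'. P e \<Longrightarrow> e \<le> e' \<Longrightarrow> P e'" for P :: "real \<Rightarrow> bool"
    proof safe
      fix e :: real assume P: "\<forall>k::nat. P (1 / real (Suc k))" and "0 < e"
      then obtain k where "1 / Suc k < e" using nat_approx_posE by blast
      then show "P e" using P mono less_imp_le by blast
    qed auto
    have "MCauchy (\<sigma> y) \<longleftrightarrow> (\<forall>e>0. \<exists>N. \<forall>n n'. N \<le> n \<longrightarrow> N \<le> n' \<longrightarrow> d (s (c y n)) (s (c y n')) < e)"
      using sS by (simp add: MCauchy_def \<sigma>_def image_subset_iff)
    also have "\<dots> \<longleftrightarrow> (\<forall>k::nat. \<exists>N. \<forall>n n'. N \<le> n \<longrightarrow> N \<le> n' \<longrightarrow> d (s (c y n)) (s (c y n')) < 1 / Suc k)"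
      by (rule archimedean) (meson less_le_trans)
    finally show ?thesis .
  qed
  then have [measurable]: "Measurable.pred borel (\<lambda>y. MCauchy (\<sigma> y))" by simp
  have gm: "g \<in> measurable borel M"
  proof (rule measurable_sigma_sets[OF sM])
    show "{U. openin X U} \<subseteq> Pow (space M)" using openin_subset X(1) by fastforce
    show "g \<in> space borel \<rightarrow> space M"
      using gS by simp
    fix U assume "U \<in> {U. openin X U}"
    then have U: "openin mtopology U" by (simp add: S(3))
    \<comment> \<open>Membership of the limit in an open set is read off from the terms: balls of
      one fixed radius about all late terms lie in \<open>U\<close>. Again the quantifiers are
      countable.\<close>
    have cauchy_case: "g y \<in> U \<longleftrightarrow> (\<exists>k::nat. \<exists>m. \<forall>j\<ge>m. mball (s (c y j)) (1 / Suc k) \<subseteq> U)" if y: "MCauchy (\<sigma> y)" for y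
    proof
      assume "g y \<in> U"
      then obtain r where r: "r > 0" "mball (g y) r \<subseteq> U" using U unfolding openin_mtopology by blast
      then obtain k where k: "1 / Suc k < r / 2" using nat_approx_posE[of "r / 2"] by auto
      have "\<forall>\<^sub>F j in sequentially. d (\<sigma> y j) (g y) < r / 2"
        using near[OF y, of "r / 2"] r(1) by simp
      then obtain m where m: "\<forall>j\<ge>m. d (\<sigma> y j) (g y) < r / 2" by (auto simp: eventually_sequentially)
      have "mball (s (c y j)) (1 / Suc k) \<subseteq> U" if "j \<ge> m" for j
      proof -
        have "mball (s (c y j)) (1 / Suc k) \<subseteq> mball (g y) r"
        proof
          fix z assume z: "z \<in> mball (s (c y j)) (1 / Suc k)"
          have "d (g y) z \<le> d (g y) (s (c y j)) + d (s (c y j)) z"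
            using z gS by (intro triangle) auto
          then show "z \<in> mball (g y) r"
            using gS[of y] z k m[rule_format, OF that] by (auto simp: \<sigma>_def commute[of "g y" "s (c y j)"])
        qed
        with r show ?thesis by blast
      qed
      then show "\<exists>k::nat. \<exists>m. \<forall>j\<ge>m. mball (s (c y j)) (1 / Suc k) \<subseteq> U" by blast
    next
      assume "\<exists>k::nat. \<exists>m. \<forall>j\<ge>m. mball (s (c y j)) (1 / Suc k) \<subseteq> U"
      then obtain k m where km: "\<forall>j\<ge>m. mball (s (c y j)) (1 / Suc k) \<subseteq> U" by blast
      have "\<forall>\<^sub>F j in sequentially. d (\<sigma> y j) (g y) < 1 / Suc k"
        by (rule near[OF y]) simp
      then obtain N where N: "\<forall>j\<ge>N. d (\<sigma> y j) (g y) < 1 / Suc k"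
        by (auto simp: eventually_sequentially)
      define j where "j = max m N"
      have "j \<ge> m" "d (\<sigma> y j) (g y) < 1 / Suc k" using N by (simp_all add: j_def)
      then have "g y \<in> mball (s (c y j)) (1 / Suc k)" using sS gS by (simp add: \<sigma>_def)
      then show "g y \<in> U" using km \<open>j \<ge> m\<close> by blast
    qed
    have g_in_U: "g y \<in> U \<longleftrightarrow> (MCauchy (\<sigma> y) \<longrightarrow>
        (\<exists>k::nat. \<exists>m. \<forall>j\<ge>m. mball (s (c y j)) (1 / Suc k) \<subseteq> U)) \<and> (\<not> MCauchy (\<sigma> y) \<longrightarrow> s 0 \<in> U)" for y
    proof (cases "MCauchy (\<sigma> y)")
      case True
      then show ?thesis using cauchy_case[OF True] by blast
    next
      case False
      then show ?thesis by (simp add: g_def)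
    qed
    have [measurable]: "Measurable.pred borel (\<lambda>y. mball (s (c y j)) e \<subseteq> U)" for j e
      by (rule pm)
    have "Measurable.pred borel (\<lambda>y. g y \<in> U)"
      unfolding g_in_U by measurable
    then show "g -` U \<inter> space borel \<in> sets borel"
      by (simp add: pred_def vimage_def)
  qed
  show ?thesis by (rule that[OF fm gm]) (simp add: gf)
qed

section \<open>Isomorphisms of non-atomic probability spaces\<close>

lemma AE_distr_eqD:
  assumes "f \<in> measurable M N" "distr M N f = N" "AE y in N. P y"
  shows "AE x in M. P (f x)"
proof -
  have "AE y in distr M N f. P y" using assms(3) by (simp only: assms(2))
  then show ?thesis by (rule AE_distrD[OF assms(1)])
qed

text \<open>Encoded as a measure on the whole real line, so that maps into and out of it are total
  Borel functions; the bounds of the interval are recovered almost everywhere.\<close>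

definition unit_lebesgue :: "real measure" where
  "unit_lebesgue = uniform_measure lborel {0<..<1}"

lemma sets_unit_lebesgue [simp, measurable_cong]: "sets unit_lebesgue = sets borel"
  and space_unit_lebesgue [simp]: "space unit_lebesgue = UNIV"
  by (simp_all add: unit_lebesgue_def)

lemma AE_unit_lebesgue_bounds: "AE t in unit_lebesgue. 0 < t \<and> t < 1"
  unfolding unit_lebesgue_def by (rule AE_uniform_measureI) auto

text \<open>\<open>a\<close> is the distribution function of the law of \<open>f\<close>, applied to
  \<open>f\<close>, and \<open>b\<close> decodes its pseudo-inverse. Null fibres make the
  distribution function continuous, so \<open>a\<close> is uniform. The last conclusion is there for
  the labels: \<open>a\<close> is monotone in the code, so a sublevel set of \<open>f\<close>
  becomes an initial interval whose length is its measure.\<close>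

lemma prob_iso_unit_lebesgue:
  fixes f :: "'a \<Rightarrow> real"
  assumes "prob_space M"
    and f [measurable]: "f \<in> borel_measurable M" and g [measurable]: "g \<in> measurable borel M"
    and gf: "\<forall>x\<in>space M. g (f x) = x"
    and atomless: "\<And>y. measure M {x \<in> space M. f x = y} = 0"
  shows "\<exists>a b. a \<in> borel_measurable M \<and> b \<in> measurable borel M \<and>
    distr M borel a = unit_lebesgue \<and> distr unit_lebesgue M b = M \<and>
    (AE x in M. b (a x) = x) \<and> (AE t in unit_lebesgue. a (b t) = t) \<and>
    (\<forall>r. AE x in M. f x \<le> r \<longleftrightarrow> a x \<le> measure M {x \<in> space M. f x \<le> r})"
proof -
  interpret M: prob_space M by fact
  let ?\<nu> = "distr M borel f"
  interpret cdf_distribution ?\<nu> by (simp add: cdf_distribution_def)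
  \<comment> \<open>\<open>I\<close> is the pseudo-inverse of the distribution function
    \<open>C\<close> on the open unit interval; the value 0 elsewhere makes it a total Borel
    function.\<close>
  define J where "J t = (if t \<in> {0<..<1} then I t else 0)" for t
  have Jm [measurable]: "J \<in> borel_measurable borel"
  proof -
    have "I \<in> borel_measurable (restrict_space borel {0<..<1})" by (rule measurable_CI)
    then have "(\<lambda>t. if t \<in> {0<..<1} then I t else 0) \<in> borel_measurable borel"
      by (subst (asm) measurable_restrict_space_iff[where c = 0]) simp_all
    then show ?thesis unfolding J_def[abs_def] .
  qed
  have distr_J: "distr unit_lebesgue borel J = ?\<nu>"
  proof (rule trans[OF measure_eqI distr_I_eq_M])
    fix A assume "A \<in> sets (distr unit_lebesgue borel J)"
    then have [measurable]: "A \<in> sets borel" by simp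
    have "{0<..<1} \<inter> J -` A = I -` A \<inter> {0<..<1}" by (auto simp: J_def)
    then show "emeasure (distr unit_lebesgue borel J) A
        = emeasure (distr (restrict_space lborel {0<..<1}) borel I) A"
      using measurable_sets_borel[OF Jm, of A]
      by (simp add: emeasure_distr unit_lebesgue_def emeasure_restrict_space space_restrict_space
          divide_ennreal_def)
  qed simp
  have "measure ?\<nu> {y} = 0" for y
  proof -
    have "f -` {y} \<inter> space M = {x \<in> space M. f x = y}" by auto
    then show ?thesis using atomless[of y] by (simp add: measure_distr)
  qed
  then have cont: "isCont C y" for y by (simp add: isCont_cdf)
  have J_order: "J t \<le> r \<longleftrightarrow> t \<le> C r" if "0 < t" "t < 1" for t r
  proof -
    have "J t = I t" using that by (simp add: J_def)
    then show ?thesis using pseudoinverse[OF that, of r] by metis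
  qed
  have CJ: "C (J t) = t" if "0 < t" "t < 1" for t
  proof (rule antisym)
    show "t \<le> C (J t)" using J_order[OF that] by blast
    show "C (J t) \<le> t"
    proof (rule ccontr)
      assume "\<not> C (J t) \<le> t"
      \<comment> \<open>\<open>J t\<close> is the least point where \<open>C\<close> reaches
        \<open>t\<close>. If \<open>C\<close> were above \<open>t\<close> there, left continuity
        would keep it above \<open>t\<close> slightly to the left, against minimality.\<close>
      have "(C \<longlongrightarrow> C (J t)) (at_left (J t))"
        using cont[of "J t"] by (simp add: isCont_def filterlim_at_split)
      then have "\<forall>\<^sub>F y in at_left (J t). t < C y"
        using \<open>\<not> C (J t) \<le> t\<close> by (auto intro: order_tendstoD)
      moreover have "\<forall>\<^sub>F y in at_left (J t). y < J t" by (simp add: eventually_at_filter)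
      ultimately have "\<forall>\<^sub>F y in at_left (J t). t < C y \<and> y < J t" by (rule eventually_conj)
      then obtain y where "t < C y" "y < J t" using eventually_happens trivial_limit_at_left_real by blast
      then show False using J_order[OF that, of y] by simp
    qed
  qed
  have CJ_AE: "AE t in unit_lebesgue. C (J t) = t"
    using AE_unit_lebesgue_bounds by eventually_elim (simp add: CJ)
  \<comment> \<open>\<open>J\<close> under Lebesgue measure and \<open>f\<close> under
    \<open>M\<close> have the same law, so identities between \<open>C\<close> and \<open>J\<close>
    need only be checked at the points \<open>J t\<close>.\<close>
  have AE_M: "AE x in M. P (f x)" if "AE t in unit_lebesgue. P (J t)" "Measurable.pred borel P" for P
  proof -
    have "AE y in distr unit_lebesgue borel J. P y"
      using that by (subst AE_distr_iff) (auto simp: pred_def)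
    then show ?thesis unfolding distr_J by (rule AE_distrD[OF f])
  qed
  have JC: "AE x in M. J (C (f x)) = f x"
    by (rule AE_M) (use CJ_AE in \<open>eventually_elim, simp\<close>, measurable)
  have bounds: "AE x in M. 0 < C (f x) \<and> C (f x) < 1"
    by (rule AE_M) (use CJ_AE AE_unit_lebesgue_bounds in \<open>eventually_elim, simp\<close>, measurable)
  have fg: "AE t in unit_lebesgue. f (g (J t)) = J t"
  proof -
    have "AE y in ?\<nu>. f (g y) = y"
      by (subst AE_distr_iff) (use gf in \<open>auto\<close>)
    then show ?thesis unfolding distr_J[symmetric] by (rule AE_distrD[rotated]) measurable
  qed
  have distr_f_J: "distr M N (\<lambda>x. h (f x)) = distr unit_lebesgue N (\<lambda>t. h (J t))"
    if [measurable]: "h \<in> measurable borel N" for h and N :: "'c measure"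
  proof -
    have "distr M N (\<lambda>x. h (f x)) = distr ?\<nu> N h" by (simp add: distr_distr comp_def)
    also have "\<dots> = distr (distr unit_lebesgue borel J) N h" by (simp only: distr_J)
    also have "\<dots> = distr unit_lebesgue N (\<lambda>t. h (J t))" by (simp add: distr_distr comp_def)
    finally show ?thesis .
  qed
  show ?thesis
  proof (intro exI[of _ "\<lambda>x. C (f x)"] exI[of _ "\<lambda>t. g (J t)"] conjI allI)
    have "distr M borel (\<lambda>x. C (f x)) = distr unit_lebesgue borel (\<lambda>t. C (J t))"
      by (rule distr_f_J) measurable
    also have "\<dots> = distr unit_lebesgue unit_lebesgue (\<lambda>t. t)"
      by (rule distr_cong_AE[OF refl _ CJ_AE]) (simp, measurable)
    finally show "distr M borel (\<lambda>x. C (f x)) = unit_lebesgue" by (simp only: distr_id)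
    have "distr unit_lebesgue M (\<lambda>t. g (J t)) = distr M M (\<lambda>x. g (f x))"
      by (rule distr_f_J[symmetric]) measurable
    also have "\<dots> = distr M M (\<lambda>x. x)" using gf by (intro distr_cong) auto
    finally show "distr unit_lebesgue M (\<lambda>t. g (J t)) = M" by (simp only: distr_id)
    show "AE x in M. g (J (C (f x))) = x"
      using JC AE_space by eventually_elim (simp add: gf)
    show "AE t in unit_lebesgue. C (f (g (J t))) = t"
      using fg CJ_AE by eventually_elim simp
    fix r
    have "f -` {..r} \<inter> space M = {x \<in> space M. f x \<le> r}" by auto
    then have "C r = measure M {x \<in> space M. f x \<le> r}" by (simp add: cdf_def2 measure_distr)
    moreover have "AE x in M. f x \<le> r \<longleftrightarrow> C (f x) \<le> C r"
      using JC bounds by eventually_elim (metis J_order)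
    ultimately show "AE x in M. f x \<le> r \<longleftrightarrow> C (f x) \<le> measure M {x \<in> space M. f x \<le> r}" by simp
  qed measurable
qed

text \<open>The label is made the integer part of the code, so that it can be read off from the
  position in the unit interval.\<close>

definition pair_code :: "real \<times> nat \<Rightarrow> real" where
  "pair_code = (\<lambda>(y, s). real s + (1 / 2 + arctan y / pi))"

definition pair_decode :: "real \<Rightarrow> real \<times> nat" where
  "pair_decode z = (tan (pi * (frac z - 1 / 2)), nat \<lfloor>z\<rfloor>)"

lemma arctan_unit: "0 < 1 / 2 + arctan y / pi" "1 / 2 + arctan y / pi < 1"
  using arctan_lbound[of y] arctan_ubound[of y] by (auto simp: field_simps)

lemma pair_decode_code [simp]: "pair_decode (pair_code p) = p"
proof (cases p)
  case (Pair y s)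
  have "\<lfloor>pair_code p\<rfloor> = int s"
    using arctan_unit[of y] by (intro floor_unique) (auto simp: pair_code_def Pair)
  then show ?thesis by (simp add: pair_decode_def frac_def) (simp add: pair_code_def Pair tan_arctan)
qed

text \<open>The codes with label \<open>s\<close> lie strictly between \<open>s\<close> and
  \<open>s + 1\<close>; hence the threshold \<open>Suc r\<close> rather than
  \<open>r\<close>.\<close>

lemma pair_code_le_iff: "pair_code (y, s) \<le> real (Suc r) \<longleftrightarrow> s \<le> r"
proof
  assume "pair_code (y, s) \<le> real (Suc r)"
  then have "real s < real (Suc r)" using arctan_unit[of y] by (simp add: pair_code_def)
  then show "s \<le> r" by simp
next
  assume "s \<le> r"
  then have "real s \<le> real r" by simp
  then show "pair_code (y, s) \<le> real (Suc r)"
    using arctan_unit[of y] by (simp add: pair_code_def)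
qed

lemma measurable_pair_code [measurable]: "pair_code \<in> borel_measurable (borel \<Otimes>\<^sub>M count_space UNIV)"
  unfolding pair_code_def by measurable

lemma measurable_pair_decode [measurable]:
  "pair_decode \<in> measurable borel (borel \<Otimes>\<^sub>M count_space UNIV)"
  unfolding pair_decode_def tan_def frac_def
  by (intro measurable_Pair measurable_compose[OF measurable_real_floor]) measurable

text \<open>Both spaces are carried to the unit interval by codes ordered by label, so the points of
  label at most \<open>s\<close> fill an initial interval of length equal to their probability.
  Equal label distributions give equal intervals, and one isomorphism followed by the inverse of the
  other respects labels.\<close>

lemma labelled_prob_iso:
  fixes f1 :: "'a \<Rightarrow> real" and f2 :: "'b \<Rightarrow> real"
  assumes "prob_space M1" "prob_space M2"
    and f1 [measurable]: "f1 \<in> borel_measurable M1" and g1 [measurable]: "g1 \<in> measurable borel M1"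
    and gf1: "\<forall>x\<in>space M1. g1 (f1 x) = x"
    and atomless1: "\<And>y. measure M1 {x \<in> space M1. f1 x = y} = 0"
    and f2 [measurable]: "f2 \<in> borel_measurable M2" and g2 [measurable]: "g2 \<in> measurable borel M2"
    and gf2: "\<forall>x\<in>space M2. g2 (f2 x) = x"
    and atomless2: "\<And>y. measure M2 {x \<in> space M2. f2 x = y} = 0"
    and l1 [measurable]: "l1 \<in> measurable M1 (count_space UNIV)"
    and l2 [measurable]: "l2 \<in> measurable M2 (count_space UNIV)"
    and labels: "\<And>s::nat. measure M1 {x \<in> space M1. l1 x \<le> s} = measure M2 {x \<in> space M2. l2 x \<le> s}"
  obtains h k
  where "h \<in> measurable M1 M2" "k \<in> measurable M2 M1" "distr M1 M2 h = M2" "distr M2 M1 k = M1"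
    "AE x in M1. k (h x) = x" "AE y in M2. h (k y) = y" "AE x in M1. l2 (h x) = l1 x"
proof -
  have step: "\<exists>a b. a \<in> borel_measurable M \<and> b \<in> measurable borel M \<and>
      distr M borel a = unit_lebesgue \<and> distr unit_lebesgue M b = M \<and>
      (AE x in M. b (a x) = x) \<and> (AE t in unit_lebesgue. a (b t) = t) \<and>
      (\<forall>s. AE x in M. l x \<le> s \<longleftrightarrow> a x \<le> measure M {x \<in> space M. l x \<le> s})"
    if "prob_space M"
    and f [measurable]: "f \<in> borel_measurable M" and g [measurable]: "g \<in> measurable borel M"
    and gf: "\<forall>x\<in>space M. g (f x) = x"
    and atomless: "\<And>y. measure M {x \<in> space M. f x = y} = 0"
    and l [measurable]: "l \<in> measurable M (count_space UNIV)"
  for M :: "'c measure" and f :: "'c \<Rightarrow> real" and g and l :: "'c \<Rightarrow> nat"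
  proof -
    interpret prob_space M by fact
    let ?f = "\<lambda>x. pair_code (f x, l x)"
    have le: "?f x \<le> real (Suc s) \<longleftrightarrow> l x \<le> s" for x s by (rule pair_code_le_iff)
    have atom: "measure M {x \<in> space M. ?f x = y} = 0" for y
    proof -
      have "measure M {x \<in> space M. ?f x = y} \<le> measure M {x \<in> space M. f x = fst (pair_decode y)}"
        by (rule finite_measure_mono) auto
      then show ?thesis
        using atomless[of "fst (pair_decode y)"] measure_nonneg[of M "{x \<in> space M. ?f x = y}"] by simp
    qed
    have m: "?f \<in> borel_measurable M" "(\<lambda>z. g (fst (pair_decode z))) \<in> measurable borel M"
      by measurable
    have dec: "\<forall>x\<in>space M. g (fst (pair_decode (?f x))) = x"
      using gf by simp
    obtain a b where ab: "a \<in> borel_measurable M" "b \<in> measurable borel M"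
      "distr M borel a = unit_lebesgue" "distr unit_lebesgue M b = M"
      "AE x in M. b (a x) = x" "AE t in unit_lebesgue. a (b t) = t"
      "\<forall>r. AE x in M. ?f x \<le> r \<longleftrightarrow> a x \<le> measure M {x \<in> space M. ?f x \<le> r}"
      using prob_iso_unit_lebesgue[OF \<open>prob_space M\<close> m dec atom] by (elim exE conjE) (rule that)
    have "\<forall>s. AE x in M. l x \<le> s \<longleftrightarrow> a x \<le> measure M {x \<in> space M. l x \<le> s}"
    proof
      fix s show "AE x in M. l x \<le> s \<longleftrightarrow> a x \<le> measure M {x \<in> space M. l x \<le> s}"
        using ab(7)[rule_format, of "real (Suc s)"] unfolding le .
    qed
    with ab(1-6) show ?thesis by (intro exI conjI)
  qed
  obtain a1 b1 where 1: "a1 \<in> borel_measurable M1" "b1 \<in> measurable borel M1"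
    "distr M1 borel a1 = unit_lebesgue" "distr unit_lebesgue M1 b1 = M1"
    "AE x in M1. b1 (a1 x) = x" "AE t in unit_lebesgue. a1 (b1 t) = t"
    "\<forall>s. AE x in M1. l1 x \<le> s \<longleftrightarrow> a1 x \<le> measure M1 {x \<in> space M1. l1 x \<le> s}"
    using step[OF \<open>prob_space M1\<close> f1 g1 gf1 atomless1 l1] by (elim exE conjE) (rule that)
  obtain a2 b2 where 2: "a2 \<in> borel_measurable M2" "b2 \<in> measurable borel M2"
    "distr M2 borel a2 = unit_lebesgue" "distr unit_lebesgue M2 b2 = M2"
    "AE x in M2. b2 (a2 x) = x" "AE t in unit_lebesgue. a2 (b2 t) = t"
    "\<forall>s. AE x in M2. l2 x \<le> s \<longleftrightarrow> a2 x \<le> measure M2 {x \<in> space M2. l2 x \<le> s}"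
    using step[OF \<open>prob_space M2\<close> f2 g2 gf2 atomless2 l2] by (elim exE conjE) (rule that)
  note [measurable] = 1(1,2) 2(1,2)
  have b2: "b2 \<in> measurable unit_lebesgue M2" by measurable
  have a1_AE: "AE x in M1. P (a1 x)" if "AE t in unit_lebesgue. P t" for P
    using that unfolding 1(3)[symmetric] by (rule AE_distrD[OF 1(1)])
  have a2_AE: "AE x in M2. P (a2 x)" if "AE t in unit_lebesgue. P t" for P
    using that unfolding 2(3)[symmetric] by (rule AE_distrD[OF 2(1)])
  have b2_AE: "AE t in unit_lebesgue. P (b2 t)" if "AE x in M2. P x" for P
    by (rule AE_distr_eqD[OF b2 2(4) that])
  show ?thesis
  proof (rule that[of "\<lambda>x. b2 (a1 x)" "\<lambda>y. b1 (a2 y)"])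
    have "distr M1 M2 (\<lambda>x. b2 (a1 x)) = distr (distr M1 borel a1) M2 b2"
      by (simp add: distr_distr comp_def)
    then show "distr M1 M2 (\<lambda>x. b2 (a1 x)) = M2" by (simp add: 1 2)
    have "distr M2 M1 (\<lambda>x. b1 (a2 x)) = distr (distr M2 borel a2) M1 b1"
      by (simp add: distr_distr comp_def)
    then show "distr M2 M1 (\<lambda>x. b1 (a2 x)) = M1" by (simp add: 1 2)
    show "AE x in M1. b1 (a2 (b2 (a1 x))) = x"
      using a1_AE[OF 2(6)] 1(5) by eventually_elim simp
    show "AE x in M2. b2 (a1 (b1 (a2 x))) = x"
      using a2_AE[OF 1(6)] 2(5) by eventually_elim simp
    \<comment> \<open>A label is determined by its sublevel sets, and countably many thresholds
      leave a single null set.\<close>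
    have "AE x in M1. \<forall>s. l2 (b2 (a1 x)) \<le> s \<longleftrightarrow> l1 x \<le> s"
      unfolding AE_all_countable
    proof
      fix s
      show "AE x in M1. l2 (b2 (a1 x)) \<le> s \<longleftrightarrow> l1 x \<le> s"
        using a1_AE[OF b2_AE[OF 2(7)[rule_format, of s]]] 1(7)[rule_format, of s] a1_AE[OF 2(6)]
        by eventually_elim (simp add: labels)
    qed
    then show "AE x in M1. l2 (b2 (a1 x)) = l1 x"
      by eventually_elim (metis order_antisym order_refl)
  qed measurable
qed

section \<open>Periodic approximation of actions\<close>

text \<open>Injectivity of the code leaves at most one point in a fibre, and a point of positive
  measure would be an atom.\<close>

lemma nonatomic_fibre:
  fixes f :: "'a \<Rightarrow> real"
  assumes "nonatomic M" and [measurable]: "f \<in> borel_measurable M"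
    and gf: "\<forall>x\<in>space M. g (f x) = x"
  shows "emeasure M {x \<in> space M. f x = y} = 0"
proof (rule ccontr)
  let ?E = "{x \<in> space M. f x = y}"
  assume "emeasure M ?E \<noteq> 0"
  then have "0 < emeasure M ?E" by (simp add: zero_less_iff_neq_zero)
  moreover have "?E \<in> sets M" by measurable
  ultimately obtain B where B: "B \<subseteq> ?E" "0 < emeasure M B" "emeasure M B < emeasure M ?E"
    using assms(1) unfolding nonatomic_def by blast
  have E: "?E \<subseteq> {g y}" using gf by auto
  then have "?E = {} \<or> ?E = {g y}" by (rule subset_singletonD)
  moreover have "B = {} \<or> B = {g y}" using subset_trans[OF B(1) E] by (rule subset_singletonD)
  ultimately have "B = {} \<or> B = ?E" using B(1) by (elim disjE) simp_all
  then show False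
  proof
    assume "B = {}"
    then show False using B(2) by simp
  next
    assume "B = ?E"
    then show False using B(3) by (metis less_irrefl)
  qed
qed

text \<open>The binary digits of the label are the membership indicators of an enumeration of the
  family. This condenses the finitely many sets to be tracked into one function.\<close>

lemma finite_family_label:
  assumes "finite \<F>" "\<F> \<subseteq> sets M"
  obtains l :: "'a \<Rightarrow> nat" where "l \<in> measurable M (count_space UNIV)"
    "\<And>x y C. l x = l y \<Longrightarrow> C \<in> \<F> \<Longrightarrow> x \<in> C \<longleftrightarrow> y \<in> C" "\<And>x. x \<notin> \<Union>\<F> \<Longrightarrow> l x = 0"
proof -
  obtain p and E :: "nat \<Rightarrow> 'a set" where F: "\<F> = E ` {i. i < p}"
    using finite_imp_nat_seg_image_inj_on[OF assms(1)] by blast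
  have [measurable]: "E i \<in> sets M" if "i < p" for i using F assms(2) that by auto
  define l where "l x = (\<Sum>i<p. if x \<in> E i then 2 ^ i else 0 :: nat)" for x
  have l: "l x = set_encode {i. i < p \<and> x \<in> E i}" for x
    unfolding l_def set_encode_def by (simp add: sum.If_cases Int_def)
  show ?thesis
  proof (rule that[of l])
    show "l \<in> measurable M (count_space UNIV)"
      unfolding l_def by (intro measurable_sum_nat) measurable
    fix x
    show "l x = 0" if "x \<notin> \<Union>\<F>" using that by (auto simp: l_def F)
    fix y C assume eq: "l x = l y" and "C \<in> \<F>"
    then obtain i where i: "i < p" "C = E i" by (auto simp: F)
    have "{i. i < p \<and> x \<in> E i} = {i. i < p \<and> y \<in> E i}"
      using eq unfolding l by (simp add: set_encode_eq)
    then show "x \<in> C \<longleftrightarrow> y \<in> C" using i by blast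
  qed
qed

lemma emeasure_vimage_transf:
  assumes "f \<in> transf M" "A \<in> sets M"
  shows "emeasure M (f -` A \<inter> space M) = emeasure M A"
  using assms emeasure_distr[of f M M A] by (simp add: transf_def)

section \<open>Transformations supported on a set of finite measure\<close>

definition extend_by_id :: "'a set \<Rightarrow> ('a \<Rightarrow> 'a) \<Rightarrow> 'a \<Rightarrow> 'a" where
  "extend_by_id B s = (\<lambda>x. if x \<in> B then s x else x)"

text \<open>Preserving the conditional measure, \<open>s\<close> keeps almost every point of
  \<open>B\<close> inside \<open>B\<close>, so the second case distinction repeats the
  first.\<close>

lemma extend_by_id_comp_AE:
  assumes B: "B \<in> sets M" "emeasure M B \<noteq> 0" "emeasure M B \<noteq> \<infinity>"
    and s: "s \<in> transf (uniform_measure M B)"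
    and eq: "AE x in uniform_measure M B. s' (s x) = s'' x"
  shows "AE x in M. extend_by_id B s' (extend_by_id B s x) = extend_by_id B s'' x"
proof -
  have AE_B: "(AE x in uniform_measure M B. P x) \<longleftrightarrow> (AE x in M. x \<in> B \<longrightarrow> P x)" for P
    using B by (subst AE_uniform_measure) (auto simp: top.not_eq_extremum)
  have "AE x in uniform_measure M B. x \<in> B" by (simp add: AE_B)
  then have "AE x in uniform_measure M B. s x \<in> B" by (rule transf_AE[OF s])
  then show ?thesis
    using eq unfolding AE_B by eventually_elim (auto simp: extend_by_id_def)
qed

lemma extend_by_id_transf:
  assumes B: "B \<in> sets M" "emeasure M B \<noteq> 0" "emeasure M B \<noteq> \<infinity>"
    and s: "s \<in> transf (uniform_measure M B)"
  shows "extend_by_id B s \<in> transf M"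
proof -
  let ?P = "uniform_measure M B"
  have sets_P: "sets ?P = sets M" by simp
  have meas: "extend_by_id B s \<in> measurable M M" if "s \<in> transf ?P" for s
  proof -
    have "s \<in> measurable M M"
      using transf_measurable[OF that] unfolding measurable_cong_sets[OF sets_P sets_P] .
    then show ?thesis unfolding extend_by_id_def by (intro measurable_If_set) (use B(1) in auto)
  qed
  obtain s' where s': "s' \<in> transf ?P" "AE x in ?P. s' (s x) = x" "AE x in ?P. s (s' x) = x"
    using transf_inverse[OF s] .
  have [measurable]: "s \<in> measurable M M"
    using transf_measurable[OF s] unfolding measurable_cong_sets[OF sets_P sets_P] .
  have cancel: "a / emeasure M B * emeasure M B = a" for a
    unfolding ennreal_divide_times
    using B(2,3) by (subst ennreal_divide_self) (auto simp: top.not_eq_extremum)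
  have "distr M M (extend_by_id B s) = M"
  proof (rule measure_eqI)
    fix A assume "A \<in> sets (distr M M (extend_by_id B s))"
    then have [measurable]: "A \<in> sets M" by simp
    have sA: "s -` A \<inter> space M \<in> sets M" by measurable
    have "emeasure ?P (s -` A \<inter> space ?P) = emeasure ?P A"
      by (rule emeasure_vimage_transf[OF s]) simp
    then have "emeasure M (B \<inter> (s -` A \<inter> space M)) / emeasure M B = emeasure M (B \<inter> A) / emeasure M B"
      unfolding space_uniform_measure emeasure_uniform_measure[OF B(1) sA]
        emeasure_uniform_measure[OF B(1) \<open>A \<in> sets M\<close>] .
    then have eq: "emeasure M (B \<inter> (s -` A \<inter> space M)) = emeasure M (B \<inter> A)"
      using cancel by metis
    have dec: "extend_by_id B s -` A \<inter> space M = (B \<inter> (s -` A \<inter> space M)) \<union> (A - B)"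
      using sets.sets_into_space[OF \<open>A \<in> sets M\<close>] sets.sets_into_space[OF B(1)]
      by (auto simp: extend_by_id_def split: if_splits)
    have "emeasure (distr M M (extend_by_id B s)) A = emeasure M (extend_by_id B s -` A \<inter> space M)"
      by (rule emeasure_distr[OF meas[OF s]]) fact
    also have "\<dots> = emeasure M (B \<inter> (s -` A \<inter> space M)) + emeasure M (A - B)"
      unfolding dec by (rule plus_emeasure[symmetric]) (use sA B(1) in auto)
    also have "\<dots> = emeasure M (B \<inter> A \<union> (A - B))"
      unfolding eq by (rule plus_emeasure) (use B(1) in auto)
    also have "B \<inter> A \<union> (A - B) = A" by blast
    finally show "emeasure (distr M M (extend_by_id B s)) A = emeasure M A" .
  qed simp
  moreover have id: "extend_by_id B (\<lambda>x. x) = (\<lambda>x. x)" by (simp add: extend_by_id_def)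
  have "AE x in M. extend_by_id B s' (extend_by_id B s x) = x"
    "AE x in M. extend_by_id B s (extend_by_id B s' x) = x"
    using extend_by_id_comp_AE[OF B s s'(2)] extend_by_id_comp_AE[OF B s'(1) s'(3)] unfolding id .
  ultimately show ?thesis
    unfolding transf_def using meas[OF s] meas[OF s'(1)] by blast
qed

section \<open>Cubes in the lattice and cyclic translations on them\<close>

definition cube :: "int \<Rightarrow> int \<Rightarrow> (int ^ 'n) set" where
  "cube a b = {q. \<forall>i. a \<le> q $ i \<and> q $ i < b}"

lemma card_cube: "card (cube a b :: (int ^ 'n::finite) set) = nat (b - a) ^ CARD('n)"
  and finite_cube: "finite (cube a b :: (int ^ 'n::finite) set)"
proof -
  have eq: "(cube a b :: (int ^ 'n) set) = vec_lambda ` (PiE UNIV (\<lambda>_. {a..<b}))"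
  proof safe
    fix q :: "int ^ 'n" assume "q \<in> cube a b"
    then show "q \<in> vec_lambda ` (PiE UNIV (\<lambda>_. {a..<b}))"
      by (intro image_eqI[of _ _ "vec_nth q"]) (auto simp: cube_def)
  qed (auto simp: cube_def PiE_iff)
  have "inj_on (vec_lambda :: ('n \<Rightarrow> int) \<Rightarrow> int ^ 'n) (PiE UNIV (\<lambda>_. {a..<b}))"
    by (auto simp: inj_on_def vec_lambda_inject)
  then show "card (cube a b :: (int ^ 'n::finite) set) = nat (b - a) ^ CARD('n)"
    unfolding eq by (simp add: card_image card_PiE)
  show "finite (cube a b :: (int ^ 'n::finite) set)"
    unfolding eq by (intro finite_imageI finite_PiE) auto
qed

text \<open>The Folner property of cubes. If \<open>K\<close> bounds all coordinates of vectors in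
  \<open>\<Gamma>\<close>, points at depth \<open>K\<close> cannot leave the cube, and the share
  \<open>(1 - 2 K / N) ^ d\<close> of these points tends to 1.\<close>

lemma cube_boundary_small:
  fixes \<Gamma> :: "(int ^ 'n::finite) set"
  assumes "finite \<Gamma>" "\<delta> > 0"
  obtains N :: nat where "N > 0"
    "\<And>\<gamma>. \<gamma> \<in> \<Gamma> \<Longrightarrow> real (card {q \<in> cube 0 (int N). q - \<gamma> \<notin> cube 0 (int N)})
        \<le> \<delta> * real (card (cube 0 (int N) :: (int ^ 'n) set))"
proof -
  define K where "K = nat (Max (insert 0 ((\<lambda>(\<gamma>, i). \<bar>\<gamma> $ i\<bar>) ` (\<Gamma> \<times> (UNIV :: 'n set)))))"
  have K: "\<bar>\<gamma> $ i\<bar> \<le> int K" if "\<gamma> \<in> \<Gamma>" for \<gamma> i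
  proof -
    have "\<bar>\<gamma> $ i\<bar> \<le> Max (insert 0 ((\<lambda>(\<gamma>, i). \<bar>\<gamma> $ i\<bar>) ` (\<Gamma> \<times> (UNIV :: 'n set))))"
      using that assms(1) by (intro Max_ge) (auto intro!: image_eqI[of _ _ "(\<gamma>, i)"])
    then show ?thesis unfolding K_def by linarith
  qed
  have "(\<lambda>N. (1 - real (2 * K) / real N) ^ CARD('n)) \<longlonglongrightarrow> (1 - 0) ^ CARD('n)"
    by (intro tendsto_intros lim_const_over_n)
  then have "\<forall>\<^sub>F N in sequentially. 1 - \<delta> < (1 - real (2 * K) / real N) ^ CARD('n)"
    using assms(2) by (intro order_tendstoD) auto
  moreover have "\<forall>\<^sub>F N in sequentially. N > 2 * K" by (rule eventually_gt_at_top)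
  ultimately have "\<forall>\<^sub>F N in sequentially. 1 - \<delta> < (1 - real (2 * K) / real N) ^ CARD('n) \<and> N > 2 * K"
    by (rule eventually_conj)
  then obtain N where N: "1 - \<delta> < (1 - real (2 * K) / real N) ^ CARD('n)" "N > 2 * K"
    using eventually_happens trivial_limit_sequentially by blast
  let ?Q = "cube 0 (int N) :: (int ^ 'n) set"
  have cQ: "card ?Q = N ^ CARD('n)" by (simp add: card_cube)
  show ?thesis
  proof (rule that[of N])
    show "N > 0" using N(2) by simp
    fix \<gamma> assume \<gamma>: "\<gamma> \<in> \<Gamma>"
    let ?W = "{q \<in> ?Q. q - \<gamma> \<notin> ?Q}" and ?I = "cube (int K) (int N - int K) :: (int ^ 'n) set"
    have "?I \<subseteq> ?Q - ?W"
    proof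
      fix q assume q: "q \<in> ?I"
      have "0 \<le> q $ i \<and> q $ i < int N \<and> 0 \<le> q $ i - \<gamma> $ i \<and> q $ i - \<gamma> $ i < int N" for i
      proof -
        have "int K \<le> q $ i \<and> q $ i < int N - int K" using q by (simp add: cube_def)
        then show ?thesis using K[OF \<gamma>, of i] by linarith
      qed
      then show "q \<in> ?Q - ?W" by (simp add: cube_def)
    qed
    then have "card ?I \<le> card (?Q - ?W)" by (intro card_mono) (auto simp: finite_cube)
    also have "\<dots> = card ?Q - card ?W"
      by (rule card_Diff_subset) (auto simp: finite_cube)
    finally have "card ?I + card ?W \<le> card ?Q"
      using card_mono[of ?Q ?W] by (simp add: finite_cube)
    then have "real (card ?I) + real (card ?W) \<le> real (card ?Q)"
      unfolding of_nat_add[symmetric] of_nat_le_iff .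
    moreover have "real (card ?I) = (1 - real (2 * K) / real N) ^ CARD('n) * real (card ?Q)"
    proof -
      have "real (card ?I) = real (N - 2 * K) ^ CARD('n)"
        by (simp add: card_cube nat_diff_distrib' flip: of_nat_power)
          (simp add: nat_minus_as_int)
      also have "real (N - 2 * K) = (1 - real (2 * K) / real N) * real N"
        using N(2) by (simp add: of_nat_diff left_diff_distrib)
      finally show ?thesis by (simp add: cQ power_mult_distrib)
    qed
    moreover have "(1 - \<delta>) * real (card ?Q) \<le> (1 - real (2 * K) / real N) ^ CARD('n) * real (card ?Q)"
      using N(1) by (intro mult_right_mono) simp_all
    ultimately have "(1 - \<delta>) * real (card ?Q) + real (card ?W) \<le> real (card ?Q)" by linarith
    then show "real (card ?W) \<le> \<delta> * real (card ?Q)" by (simp add: left_diff_distrib)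
  qed
qed

definition cube_shift :: "nat \<Rightarrow> int ^ 'n \<Rightarrow> int ^ 'n \<Rightarrow> int ^ 'n" where
  "cube_shift N v q = (\<chi> i. (q $ i + v $ i) mod int N)"

lemma cube_shift_add: "cube_shift N v (cube_shift N w q) = cube_shift N (v + w) q"
  by (simp add: cube_shift_def vec_eq_iff mod_add_left_eq) (simp add: algebra_simps)

lemma cube_shift_eq: "q + v \<in> cube 0 (int N) \<Longrightarrow> cube_shift N v q = q + v"
  by (simp add: cube_shift_def cube_def vec_eq_iff)

lemma cube_shift_0: "q \<in> cube 0 (int N) \<Longrightarrow> cube_shift N 0 q = q"
  using cube_shift_eq[of q 0] by simp

lemma cube_shift_mem: "N > 0 \<Longrightarrow> cube_shift N v q \<in> cube 0 (int N)"
  by (simp add: cube_shift_def cube_def)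

text \<open>Compared with \<open>cube_shift N 0\<close> rather than with \<open>q\<close>, because
  off the cube even the shift by 0 reduces modulo \<open>N\<close>.\<close>

lemma cube_shift_multiple: "cube_shift N (\<chi> i. int N * v $ i) q = cube_shift N 0 q"
  by (simp add: cube_shift_def vec_eq_iff)

lemma bij_betw_cube_shift:
  assumes "N > 0"
  shows "bij_betw (cube_shift N v) (cube 0 (int N)) (cube 0 (int N))"
proof (rule bij_betw_byWitness[of _ "cube_shift N (- v)"])
  show "\<forall>q\<in>cube 0 (int N). cube_shift N (- v) (cube_shift N v q) = q"
    "\<forall>q\<in>cube 0 (int N). cube_shift N v (cube_shift N (- v) q) = q"
    by (simp_all add: cube_shift_add cube_shift_0)
qed (use cube_shift_mem[OF assms] in blast)+

section \<open>Actions through pointwise representatives\<close>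

lemma transf_class_eqD:
  assumes "f \<in> transf M" "transf_class M f = transf_class M g"
  shows "AE x in M. f x = g x"
  using transf_class_self[OF assms(1)] assms(2) by (auto simp: transf_class_def)

text \<open>Cancel one \<open>f\<close> by its inverse mod 0. This turns additivity at
  \<open>0 + 0\<close> into the statement that the representative at 0 is the identity.\<close>

lemma transf_idempotent:
  assumes f: "f \<in> transf M" and idem: "AE x in M. f (f x) = f x"
  shows "AE x in M. f x = x"
proof -
  obtain g where g: "g \<in> transf M" "AE x in M. g (f x) = x" using transf_inverse[OF f] .
  show ?thesis using transf_AE[OF f g(2)] g(2) idem by eventually_elim simp
qed

text \<open>Equality of classes gives the homomorphism law with an exceptional null set for each
  pair of vectors.\<close>

lemma action_representatives:
  assumes T: "T \<in> actions M"
  obtains t where "\<And>v. t v \<in> transf M" "\<And>v. T v = transf_class M (t v)"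
    "\<And>v w. AE x in M. t (v + w) x = t v (t w x)" "AE x in M. t 0 x = x"
proof -
  have "T v \<in> transf_class M ` transf M" for v
    using T by (auto simp: actions_def hom_def lattice_group_def aut_carrier)
  then have "\<forall>v. \<exists>f. f \<in> transf M \<and> T v = transf_class M f" by blast
  from choice[OF this] obtain t where t: "\<And>v. t v \<in> transf M" "\<And>v. T v = transf_class M (t v)" by blast
  have add: "AE x in M. t (v + w) x = t v (t w x)" for v w
  proof -
    have "T (v + w) = T v \<otimes>\<^bsub>aut_group M\<^esub> T w"
      using T by (simp add: actions_def hom_def lattice_group_def)
    then have "transf_class M (t (v + w)) = transf_class M (t v \<circ> t w)"
      by (simp add: t aut_mult)
    from transf_class_eqD[OF t(1) this] show ?thesis by simp
  qed
  have "AE x in M. t 0 (t 0 x) = t 0 x" using add[of 0 0] by eventually_elim simp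
  then show ?thesis using that t add transf_idempotent[OF t(1)] by blast
qed

lemma action_from_transf:
  assumes "\<And>v. s v \<in> transf M" "\<And>v w. AE x in M. s (v + w) x = s v (s w x)"
  shows "(\<lambda>v. transf_class M (s v)) \<in> actions M"
proof -
  have "transf_class M (s (v + w)) = transf_class M (s v) \<otimes>\<^bsub>aut_group M\<^esub> transf_class M (s w)" for v w
    using assms transf_class_cong[where f = "s (v + w)" and g = "s v \<circ> s w"] by (simp add: aut_mult)
  then show ?thesis
    using assms(1) by (simp add: actions_def hom_def lattice_group_def aut_carrier)
qed

lemma aut_image_action_AE:
  fixes t :: "int ^ 'n \<Rightarrow> 'a \<Rightarrow> 'a"
  assumes t: "\<And>v. t v \<in> transf M" "\<And>v w. AE x in M. t (v + w) x = t v (t w x)"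
  shows "AE x in M. x \<in> aut_image M (transf_class M (t v)) A \<longleftrightarrow> t (- v) x \<in> A"
proof (rule aut_image_AE)
  have "AE x in M. t 0 (t 0 x) = t 0 x" using t(2)[of 0 0] by eventually_elim simp
  from transf_idempotent[OF t(1) this] t(2)[of "- v" v]
  show "AE x in M. t (- v) (t v x) = x" by eventually_elim simp
qed (rule t)+

section \<open>The model space: a conditional measure times the uniform law on a finite set\<close>

lemma emeasure_pair_pmf_of_set:
  fixes Q :: "'q::countable set"
  assumes P: "prob_space P" and Q: "finite Q" "Q \<noteq> {}" and W: "W \<subseteq> Q"
    and D: "\<And>q. q \<in> W \<Longrightarrow> D q \<in> sets P"
  shows "{z. snd z \<in> W \<and> fst z \<in> D (snd z)} \<in> sets (P \<Otimes>\<^sub>M measure_pmf (pmf_of_set Q))" (is "?Z \<in> _")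
    and "emeasure (P \<Otimes>\<^sub>M measure_pmf (pmf_of_set Q)) {z. snd z \<in> W \<and> fst z \<in> D (snd z)}
        = (\<Sum>q\<in>W. emeasure P (D q)) / of_nat (card Q)"
proof -
  interpret P: prob_space P by fact
  interpret pair_sigma_finite P "measure_pmf (pmf_of_set Q)" ..
  have "?Z = (\<Union>q\<in>W. D q \<times> {q})" by auto
  also have "\<dots> \<in> sets (P \<Otimes>\<^sub>M measure_pmf (pmf_of_set Q))"
    using D finite_subset[OF W Q(1)] by (intro sets.finite_UN) auto
  finally show Z: "?Z \<in> sets (P \<Otimes>\<^sub>M measure_pmf (pmf_of_set Q))" .
  have "emeasure (P \<Otimes>\<^sub>M measure_pmf (pmf_of_set Q)) ?Z
      = (\<integral>\<^sup>+q. emeasure P ((\<lambda>y. (y, q)) -` ?Z) \<partial>measure_pmf (pmf_of_set Q))"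
    by (rule emeasure_pair_measure_alt2[OF Z])
  also have "\<dots> = (\<Sum>q\<in>Q. emeasure P ((\<lambda>y. (y, q)) -` ?Z)) / of_nat (card Q)"
    using Q by (simp add: nn_integral_pmf_of_set ennreal_of_nat_eq_real_of_nat)
  also have "(\<Sum>q\<in>Q. emeasure P ((\<lambda>y. (y, q)) -` ?Z)) = (\<Sum>q\<in>W. emeasure P (D q))"
    by (rule sum.mono_neutral_cong_right) (use Q(1) W in \<open>auto simp: vimage_def\<close>)
  finally show "emeasure (P \<Otimes>\<^sub>M measure_pmf (pmf_of_set Q)) ?Z
      = (\<Sum>q\<in>W. emeasure P (D q)) / of_nat (card Q)" .
qed

text \<open>\<open>labelled_prob_iso\<close> applies because the product is again coded by reals
  with null fibres: a fibre of its code lies over a single fibre of \<open>f\<close>, which is null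
  since the measure is non-atomic.\<close>

lemma cyclic_model_iso:
  fixes M :: "'a measure" and Q :: "'q::countable set"
  defines "P B \<equiv> uniform_measure M B" and "M2 B \<equiv> uniform_measure M B \<Otimes>\<^sub>M measure_pmf (pmf_of_set Q)"
  assumes M: "standard_borel M" "nonatomic M"
    and B: "B \<in> sets M" "emeasure M B \<noteq> 0" "emeasure M B \<noteq> \<infinity>"
    and Q: "finite Q" "Q \<noteq> {}"
    and l1: "l1 \<in> measurable (P B) (count_space UNIV)" and l2: "l2 \<in> measurable (M2 B) (count_space UNIV)"
    and labels: "\<And>s::nat. measure (P B) {x \<in> space (P B). l1 x \<le> s} = measure (M2 B) {z \<in> space (M2 B). l2 z \<le> s}"
  obtains h k
  where "h \<in> measurable (P B) (M2 B)" "k \<in> measurable (M2 B) (P B)"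
    "distr (P B) (M2 B) h = M2 B" "distr (M2 B) (P B) k = P B"
    "AE x in P B. k (h x) = x" "AE z in M2 B. h (k z) = z" "AE x in P B. l2 (h x) = l1 x"
proof -
  have "B \<noteq> {}" using B(2) by auto
  then have "space M \<noteq> {}" using sets.sets_into_space[OF B(1)] by blast
  from standard_borel_code[OF M(1) this] obtain f :: "'a \<Rightarrow> real" and g
    where f: "f \<in> borel_measurable M" and g: "g \<in> measurable borel M"
      and gf: "\<And>x. x \<in> space M \<Longrightarrow> g (f x) = x" by blast
  have sets_P [measurable_cong]: "sets (P B) = sets M" and space_P: "space (P B) = space M"
    by (simp_all add: P_def)
  have space_M2: "space (M2 B) = space M \<times> UNIV" by (simp add: M2_def space_pair_measure)
  have M2: "M2 B = P B \<Otimes>\<^sub>M measure_pmf (pmf_of_set Q)" by (simp add: M2_def P_def)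
  interpret P: prob_space "P B" unfolding P_def by (rule prob_space_uniform_measure[OF B(2,3)])
  have "prob_space (M2 B)"
    unfolding M2 by (rule prob_space_pair[OF P.prob_space_axioms prob_space_measure_pmf])
  have fP [measurable]: "f \<in> borel_measurable (P B)" using f by (simp cong: measurable_cong_sets add: sets_P)
  have gP [measurable]: "g \<in> measurable borel (P B)" using g by (simp cong: measurable_cong_sets add: sets_P)
  have fibre: "emeasure (P B) {x \<in> space (P B). f x = y} = 0" for y
  proof -
    have "emeasure M {x \<in> space M. f x = y} = 0"
      by (rule nonatomic_fibre[where g = g, OF M(2) f]) (use gf in blast)
    moreover have "emeasure M (B \<inter> {x \<in> space M. f x = y}) \<le> emeasure M {x \<in> space M. f x = y}"
      by (rule emeasure_mono) (use f in measurable)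
    ultimately show ?thesis
      unfolding P_def space_uniform_measure using B(1) f by (subst emeasure_uniform_measure) auto
  qed
  \<comment> \<open>\<open>pair_code\<close> is reused here with the element of \<open>Q\<close>,
    numbered by \<open>to_nat\<close>, in the place of the label.\<close>
  let ?f = "\<lambda>z. pair_code (f (fst z), to_nat (snd z))"
  let ?g = "\<lambda>z. (g (fst (pair_decode z)), from_nat (snd (pair_decode z)) :: 'q)"
  have f2: "?f \<in> borel_measurable (M2 B)" unfolding M2 by measurable
  have g2: "?g \<in> measurable borel (M2 B)" unfolding M2 by measurable
  have fibre2: "measure (M2 B) {z \<in> space (M2 B). ?f z = y} = 0" for y
  proof -
    let ?F = "{x \<in> space (P B). f x = fst (pair_decode y)}"
    have "emeasure (M2 B) (?F \<times> UNIV) = 0"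
      unfolding M2 by (subst measure_pmf.emeasure_pair_measure_Times) (auto simp: fibre)
    moreover have "emeasure (M2 B) {z \<in> space (M2 B). ?f z = y} \<le> emeasure (M2 B) (?F \<times> UNIV)"
      by (rule emeasure_mono) (auto simp: M2 space_pair_measure)
    ultimately show ?thesis by (simp add: measure_def)
  qed
  have dec1: "\<forall>x\<in>space (P B). g (f x) = x" using gf by (simp add: space_P)
  have dec2: "\<forall>z\<in>space (M2 B). ?g (?f z) = z" using gf by (auto simp: space_M2)
  have fibre1: "measure (P B) {x \<in> space (P B). f x = y} = 0" for y using fibre by (simp add: measure_def)
  show ?thesis
    by (rule labelled_prob_iso[OF P.prob_space_axioms \<open>prob_space (M2 B)\<close> fP gP dec1 fibre1
          f2 g2 dec2 fibre2 l1 l2 labels]) (rule that)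
qed

text \<open>Each slice over \<open>W\<close> has conditional measure at most \<open>a / m\<close>
  with \<open>m\<close> the mass of \<open>B\<close>, and \<open>W\<close> is a fraction
  \<open>\<delta>\<close> of all slices; undoing the normalisation cancels \<open>m\<close>. That
  the bound is free of \<open>B\<close> is essential: \<open>B\<close> is built from the cube, which
  is chosen after \<open>\<delta>\<close>.\<close>

lemma cyclic_model_emeasure_le:
  fixes M :: "'a measure" and Q :: "'q::countable set"
  assumes B: "B \<in> sets M" "emeasure M B \<noteq> 0" "emeasure M B \<noteq> \<infinity>"
    and Q: "finite Q" "Q \<noteq> {}" and W: "W \<subseteq> Q" "real (card W) \<le> \<delta> * real (card Q)"
    and h: "h \<in> measurable (uniform_measure M B) (uniform_measure M B \<Otimes>\<^sub>M measure_pmf (pmf_of_set Q))"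
      "distr (uniform_measure M B) (uniform_measure M B \<Otimes>\<^sub>M measure_pmf (pmf_of_set Q)) h
        = uniform_measure M B \<Otimes>\<^sub>M measure_pmf (pmf_of_set Q)"
    and D: "\<And>q. q \<in> W \<Longrightarrow> D q \<in> sets M" "\<And>q. q \<in> W \<Longrightarrow> emeasure M (D q) \<le> ennreal a" and "a \<ge> 0"
  shows "{x \<in> B. snd (h x) \<in> W \<and> fst (h x) \<in> D (snd (h x))} \<in> sets M"
    and "emeasure M {x \<in> B. snd (h x) \<in> W \<and> fst (h x) \<in> D (snd (h x))} \<le> ennreal (\<delta> * a)"
proof -
  let ?P = "uniform_measure M B"
  let ?M2 = "?P \<Otimes>\<^sub>M measure_pmf (pmf_of_set Q)"
  let ?Z = "{z. snd z \<in> W \<and> fst z \<in> D (snd z)}"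
  let ?X = "{x \<in> B. snd (h x) \<in> W \<and> fst (h x) \<in> D (snd (h x))}"
  have P: "prob_space ?P" by (rule prob_space_uniform_measure[OF B(2,3)])
  have Z: "?Z \<in> sets ?M2"
    by (rule emeasure_pair_pmf_of_set(1)[OF P Q W(1)]) (use D in simp)
  have hZ: "h -` ?Z \<inter> space M \<in> sets M" using measurable_sets[OF h(1) Z] by simp
  have X: "?X = B \<inter> (h -` ?Z \<inter> space M)" using sets.sets_into_space[OF B(1)] by auto
  show "?X \<in> sets M" unfolding X using B(1) hZ by blast
  define m where "m = measure M B"
  have m: "emeasure M B = ennreal m" "m > 0"
  proof -
    show "emeasure M B = ennreal m" using B(3) by (simp add: m_def emeasure_eq_ennreal_measure)
    then show "m > 0" using B(2) by (metis ennreal_eq_0_iff not_less)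
  qed
  have cQ: "card Q > 0" using Q by (simp add: card_gt_0_iff)
  have Dle: "emeasure ?P (D q) \<le> ennreal (a / m)" if "q \<in> W" for q
  proof -
    have "emeasure ?P (D q) = emeasure M (B \<inter> D q) / ennreal m"
      using emeasure_uniform_measure[OF B(1) D(1)[OF that]] by (simp add: m)
    also have "emeasure M (B \<inter> D q) \<le> emeasure M (D q)" using D(1)[OF that] by (intro emeasure_mono) auto
    also have "emeasure M (D q) \<le> ennreal a" using D(2)[OF that] .
    also have "ennreal a / ennreal m = ennreal (a / m)" using m(2) \<open>a \<ge> 0\<close> by (simp add: divide_ennreal)
    finally show ?thesis by (simp add: divide_right_mono_ennreal)
  qed
  have "emeasure M ?X / ennreal m = emeasure ?P (h -` ?Z \<inter> space ?P)"
    unfolding X using emeasure_uniform_measure[OF B(1) hZ] by (simp add: m)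
  also have "\<dots> = emeasure ?M2 ?Z"
    using emeasure_distr[OF h(1) Z] unfolding h(2) by simp
  also have "\<dots> = (\<Sum>q\<in>W. emeasure ?P (D q)) / of_nat (card Q)"
    by (rule emeasure_pair_pmf_of_set(2)[OF P Q W(1)]) (use D in simp)
  also have "\<dots> \<le> (\<Sum>q\<in>W. ennreal (a / m)) / of_nat (card Q)"
    by (intro divide_right_mono_ennreal sum_mono Dle)
  also have "\<dots> = ennreal (real (card W) * (a / m) / real (card Q))"
    using \<open>a \<ge> 0\<close> m(2) cQ
    by (simp add: ennreal_of_nat_eq_real_of_nat divide_ennreal ennreal_mult'[symmetric])
  finally have "emeasure M ?X / ennreal m * ennreal m \<le> ennreal (real (card W) * (a / m) / real (card Q)) * ennreal m"
    by (rule mult_right_mono) simp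
  also have "emeasure M ?X / ennreal m * ennreal m = emeasure M ?X"
    using m(2) by (simp add: ennreal_divide_times ennreal_divide_self)
  also have "ennreal (real (card W) * (a / m) / real (card Q)) * ennreal m
      = ennreal (real (card W) * (a / m) / real (card Q) * m)"
    using \<open>a \<ge> 0\<close> m(2) by (intro ennreal_mult[symmetric]) simp_all
  also have "real (card W) * (a / m) / real (card Q) * m = real (card W) / real (card Q) * a"
    using m(2) by simp
  also have "ennreal \<dots> \<le> ennreal (\<delta> * a)"
    using W(2) cQ \<open>a \<ge> 0\<close> by (intro ennreal_leI mult_right_mono) (simp_all add: divide_le_eq)
  finally show "emeasure M ?X \<le> ennreal (\<delta> * a)" .
qed

definition shift_snd :: "nat \<Rightarrow> int ^ 'n \<Rightarrow> 'a \<times> (int ^ 'n) \<Rightarrow> 'a \<times> (int ^ 'n)" where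
  "shift_snd N v z = (fst z, cube_shift N v (snd z))"

text \<open>The uniform law on the cube is invariant under a bijection of the cube, and the first
  coordinate is left alone.\<close>

lemma distr_shift_snd:
  fixes v :: "int ^ 'n::finite" and P :: "'a measure"
  assumes "prob_space P" "N > 0"
  defines "M2 \<equiv> P \<Otimes>\<^sub>M measure_pmf (pmf_of_set (cube 0 (int N) :: (int ^ 'n) set))"
  shows "shift_snd N v \<in> measurable M2 M2" "distr M2 M2 (shift_snd N v) = M2"
proof -
  let ?p = "pmf_of_set (cube 0 (int N) :: (int ^ 'n) set)"
  interpret P: prob_space P by fact
  have ne: "(cube 0 (int N) :: (int ^ 'n) set) \<noteq> {}" using cube_shift_mem[OF assms(2), of 0 0] by blast
  have [measurable]: "cube_shift N v \<in> measurable (measure_pmf ?p) (measure_pmf ?p)" by simp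
  show "shift_snd N v \<in> measurable M2 M2" unfolding shift_snd_def[abs_def] M2_def by measurable
  have "distr (measure_pmf ?p) (measure_pmf ?p) (cube_shift N v)
      = distr (measure_pmf ?p) (count_space UNIV) (cube_shift N v)"
    by (rule distr_cong) auto
  also have "\<dots> = measure_pmf ?p"
    unfolding map_pmf_rep_eq[symmetric]
    by (subst map_pmf_of_set_bij_betw[OF bij_betw_cube_shift[OF assms(2)] ne finite_cube]) simp
  finally have shift: "distr (measure_pmf ?p) (measure_pmf ?p) (cube_shift N v) = measure_pmf ?p" .
  have "distr P P (\<lambda>x. x) \<Otimes>\<^sub>M distr (measure_pmf ?p) (measure_pmf ?p) (cube_shift N v)
      = distr M2 M2 (\<lambda>(x, q). (x, cube_shift N v q))"
    unfolding M2_def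
    by (rule pair_measure_distr) (simp_all add: shift measure_pmf.sigma_finite_measure_axioms)
  moreover have "(\<lambda>(x :: 'a, q). (x, cube_shift N v q)) = shift_snd N v"
    by (auto simp: shift_snd_def)
  ultimately have "P \<Otimes>\<^sub>M measure_pmf ?p = distr M2 M2 (shift_snd N v)"
    by (simp only: shift distr_id)
  then show "distr M2 M2 (shift_snd N v) = M2" unfolding M2_def by (rule sym)
qed

text \<open>Rotation of the cube coordinate, conjugated to \<open>P\<close> by the isomorphism.
  Relations that pass through \<open>h (k z) = z\<close> hold almost everywhere; the period is
  visible in the formula and holds at every point.\<close>

lemma cyclic_model_action:
  fixes N :: nat
  defines "M2 P \<equiv> P \<Otimes>\<^sub>M measure_pmf (pmf_of_set (cube 0 (int N) :: (int ^ 'n::finite) set))"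
  assumes P: "prob_space P" and N: "N > 0"
    and h: "h \<in> measurable P (M2 P)" "distr P (M2 P) h = M2 P"
    and k: "k \<in> measurable (M2 P) P" "distr (M2 P) P k = P"
    and kh: "AE x in P. k (h x) = x" and hk: "AE z in M2 P. h (k z) = z"
  defines "s v x \<equiv> k (shift_snd N v (h x))"
  shows "s v \<in> transf P" "AE x in P. s (v + w) x = s v (s w x)" "AE x in P. s 0 x = x"
    "s (\<chi> i. int N * v $ i) x = s 0 x" "AE x in P. snd (h x) \<in> cube 0 (int N)"
proof -
  let ?Q = "cube 0 (int N) :: (int ^ 'n) set"
  interpret P: prob_space P by fact
  have ne: "?Q \<noteq> {}" using cube_shift_mem[OF N, of 0 0] by blast
  have M2: "M2 P = P \<Otimes>\<^sub>M measure_pmf (pmf_of_set ?Q)" by (simp add: M2_def)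
  interpret pair: pair_prob_space P "measure_pmf (pmf_of_set ?Q)" ..
  have shift: "shift_snd N v \<in> measurable (M2 P) (M2 P)" "distr (M2 P) (M2 P) (shift_snd N v) = M2 P" for v
    unfolding M2 by (rule distr_shift_snd[OF P N])+
  note [measurable] = h(1) k(1) shift(1)
  have h_AE: "AE x in P. R (h x)" if "AE z in M2 P. R z" for R
    by (rule AE_distr_eqD[OF h that])
  \<comment> \<open>The identity \<open>h (k z) = z\<close> may be used at
    \<open>z = shift_snd N w (h x)\<close> since both \<open>h\<close> and the shift preserve
    measure and so pull null sets back to null sets.\<close>
  have hs: "AE x in P. h (s w x) = shift_snd N w (h x)" for w
    unfolding s_def by (rule h_AE) (rule AE_distr_eqD[OF shift hk])
  show add: "AE x in P. s (v + w) x = s v (s w x)" for v w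
    using hs[of w] by eventually_elim (simp add: s_def shift_snd_def cube_shift_add)
  have "AE z in M2 P. snd z \<in> ?Q"
    unfolding M2
  proof (rule pair.AE_pair_measure)
    show "{z \<in> space (P \<Otimes>\<^sub>M measure_pmf (pmf_of_set ?Q)). snd z \<in> ?Q} \<in> sets (P \<Otimes>\<^sub>M measure_pmf (pmf_of_set ?Q))"
      by measurable
    show "AE x in P. AE q in measure_pmf (pmf_of_set ?Q). snd (x, q) \<in> ?Q"
      using ne by (simp add: AE_measure_pmf_iff finite_cube set_pmf_of_set)
  qed
  then show Q: "AE x in P. snd (h x) \<in> ?Q" by (rule h_AE)
  show zero: "AE x in P. s 0 x = x"
    using Q kh by eventually_elim (simp add: s_def shift_snd_def cube_shift_0)
  show "s (\<chi> i. int N * v $ i) x = s 0 x"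
    by (simp add: s_def shift_snd_def cube_shift_multiple)
  have sm: "s v \<in> measurable P P" for v
    unfolding s_def by measurable
  have "distr P P (s v) = P" for v
  proof -
    have "distr P P (s v) = distr (distr (distr P (M2 P) h) (M2 P) (shift_snd N v)) P k"
      unfolding s_def by (simp add: distr_distr comp_def)
    then show ?thesis by (simp only: h(2) shift(2) k(2))
  qed
  moreover have "AE x in P. s v (s w x) = x" if "v + w = 0" for v w
    using add[of v w] zero unfolding that by eventually_elim simp
  from this[of "- v" v] this[of v "- v"]
  have "AE x in P. s (- v) (s v x) = x" "AE x in P. s v (s (- v) x) = x" by simp_all
  ultimately show "s v \<in> transf P"
    unfolding transf_def using sm by blast
qed

text \<open>\<open>(y, q) \<mapsto> t q y\<close> may leave \<open>B\<close>, but a set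
  \<open>E\<close> inside \<open>U\<close> has all its preimages inside \<open>B\<close>. Each slice
  therefore has the conditional measure of \<open>E\<close> itself, and so has their
  average.\<close>

lemma cyclic_model_labels:
  fixes M :: "'a measure" and Q :: "'q::countable set"
  assumes B: "B \<in> sets M" "emeasure M B \<noteq> 0" "emeasure M B \<noteq> \<infinity>"
    and Q: "finite Q" "Q \<noteq> {}"
    and t: "\<And>q. q \<in> Q \<Longrightarrow> t q \<in> transf M"
    and l: "l \<in> measurable M (count_space UNIV)" and U: "U \<subseteq> B" "\<And>x. x \<notin> U \<Longrightarrow> l x = (0::nat)"
    and tU: "\<And>q. q \<in> Q \<Longrightarrow> t q -` U \<inter> space M \<subseteq> B"
  defines "P \<equiv> uniform_measure M B" and "M2 \<equiv> uniform_measure M B \<Otimes>\<^sub>M measure_pmf (pmf_of_set Q)"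
    and "l2 z \<equiv> if snd z \<in> Q then l (t (snd z) (fst z)) else 0"
  shows "l2 \<in> measurable M2 (count_space UNIV)"
    and "measure P {x \<in> space P. l x \<le> s} = measure M2 {z \<in> space M2. l2 z \<le> s}"
proof -
  have sets_P [measurable_cong]: "sets P = sets M" and space_P: "space P = space M" by (simp_all add: P_def)
  have M2: "M2 = P \<Otimes>\<^sub>M measure_pmf (pmf_of_set Q)" by (simp add: M2_def P_def)
  have P: "prob_space P" unfolding P_def by (rule prob_space_uniform_measure[OF B(2,3)])
  have prob_M2: "prob_space M2" unfolding M2 by (rule prob_space_pair[OF P prob_space_measure_pmf])
  have lt: "(\<lambda>y. if q \<in> Q then l (t q y) else 0) \<in> measurable P (count_space UNIV)" for q
  proof (cases "q \<in> Q")
    case True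
    have "(\<lambda>y. l (t q y)) \<in> measurable M (count_space UNIV)"
      using measurable_compose[OF transf_measurable[OF t[OF True]] l] .
    then show ?thesis using True by (simp cong: measurable_cong_sets add: sets_P)
  qed simp
  have "(\<lambda>z. if snd z \<in> Q then l (t (snd z) (fst z)) else 0) \<in> measurable M2 (count_space UNIV)"
    unfolding M2
  proof (rule measurable_compose_countable[where f = "\<lambda>q z. if q \<in> Q then l (t q (fst z)) else 0" and g = snd])
    fix q
    show "(\<lambda>z. if q \<in> Q then l (t q (fst z)) else 0) \<in> measurable (P \<Otimes>\<^sub>M measure_pmf (pmf_of_set Q)) (count_space UNIV)"
      using measurable_compose[OF measurable_fst lt[of q]] .
    show "snd \<in> measurable (P \<Otimes>\<^sub>M measure_pmf (pmf_of_set Q)) (count_space UNIV)"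
      using measurable_compose[OF measurable_snd, of "\<lambda>x. x" "measure_pmf (pmf_of_set Q)" "count_space UNIV" P] by simp
  qed
  then show l2: "l2 \<in> measurable M2 (count_space UNIV)" unfolding l2_def[abs_def] by simp
  \<comment> \<open>The strict superlevel set never contains a point of label 0, so it lies in
    \<open>U\<close> for every \<open>s\<close>; sublevel sets are then treated as
    complements.\<close>
  define E where "E = {x \<in> space M. s < l x}"
  have E: "E \<in> sets M" unfolding E_def using l by measurable
  have "E \<subseteq> U" using U(2) by (force simp: E_def)
  define D where "D q = t q -` E \<inter> space M" for q
  have D: "D q \<in> sets M" "D q \<subseteq> B" "emeasure M (D q) = emeasure M E" if "q \<in> Q" for q
  proof -
    show "D q \<in> sets M" unfolding D_def using measurable_sets[OF transf_measurable[OF t[OF that]] E] .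
    show "D q \<subseteq> B" using tU[OF that] \<open>E \<subseteq> U\<close> by (auto simp: D_def)
    show "emeasure M (D q) = emeasure M E" unfolding D_def by (rule emeasure_vimage_transf[OF t[OF that] E])
  qed
  define x where "x = emeasure M E / emeasure M B"
  have PD: "emeasure P (D q) = x" if "q \<in> Q" for q
    unfolding P_def x_def using emeasure_uniform_measure[OF B(1) D(1)[OF that]] D(2,3)[OF that]
    by (simp add: Int_absorb1)
  have PE: "emeasure P E = x"
    unfolding P_def x_def using emeasure_uniform_measure[OF B(1) E] \<open>E \<subseteq> U\<close> U(1)
    by (simp add: Int_absorb1)
  let ?Z = "{z. snd z \<in> Q \<and> fst z \<in> D (snd z)}"
  have Z: "?Z \<in> sets M2"
    unfolding M2 by (rule emeasure_pair_pmf_of_set(1)[OF P Q subset_refl]) (simp add: D sets_P)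
  have "emeasure M2 ?Z = (\<Sum>q\<in>Q. emeasure P (D q)) / of_nat (card Q)"
    unfolding M2 by (rule emeasure_pair_pmf_of_set(2)[OF P Q subset_refl]) (simp add: D sets_P)
  also have "\<dots> = x * of_nat (card Q) / of_nat (card Q)" by (simp add: PD mult.commute)
  also have "\<dots> = x" using Q by (intro mult_divide_eq_ennreal) (auto simp: ennreal_of_nat_eq_real_of_nat)
  finally have "measure P E = measure M2 ?Z" using PE by (simp add: measure_def)
  moreover have "{x \<in> space P. l x \<le> s} = space P - E" by (auto simp: E_def space_P)
  moreover have "{z \<in> space M2. l2 z \<le> s} = space M2 - ?Z"
  proof -
    have tx: "t q y \<in> space M" if "q \<in> Q" "y \<in> space M" for q y
      using measurable_space[OF transf_measurable[OF t[OF that(1)]] that(2)] .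
    show ?thesis
      by (auto simp: l2_def D_def E_def M2 space_pair_measure space_P not_less tx split: if_splits)
  qed
  moreover have "measure P (space P - E) = 1 - measure P E"
    by (rule prob_space.prob_compl[OF P]) (simp add: E sets_P)
  moreover have "measure M2 (space M2 - ?Z) = 1 - measure M2 ?Z"
    by (rule prob_space.prob_compl[OF prob_M2 Z])
  ultimately show "measure P {x \<in> space P. l x \<le> s} = measure M2 {z \<in> space M2. l2 z \<le> s}" by simp
qed

text \<open>The space \<open>B \<times> (\<int>/N)\<^sup>d\<close> maps to \<open>X\<close> by \<open>(y, q) \<mapsto> T\<^sub>q y\<close>.  This map preserves the
  measure over the relevant sets and intertwines the rotation of the second coordinate with \<open>T\<close>
  except near the boundary of the cube.  Transporting the rotation to \<open>B\<close> along an isomorphism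
  that matches the relevant sets with their preimages gives a periodic action close to \<open>T\<close>.\<close>

lemma periodic_approximation:
  fixes M :: "'a measure" and T :: "int ^ 'n::finite \<Rightarrow> ('a \<Rightarrow> 'a) set"
  assumes M: "standard_borel M" "nonatomic M" and T: "T \<in> actions M"
    and A0: "A0 \<in> sets M" "emeasure M A0 \<noteq> 0" "emeasure M A0 \<noteq> \<infinity>"
    and \<A>: "finite \<A>" "\<A> \<subseteq> sets M" "\<And>A. A \<in> \<A> \<Longrightarrow> emeasure M A \<noteq> \<infinity>"
    and \<Gamma>: "finite \<Gamma>" and e: "e > 0"
  obtains T' N where "T' \<in> actions M" "N > 0" "\<And>v. T' (\<chi> i. int N * v $ i) = \<one>\<^bsub>aut_group M\<^esub>"
    "\<And>A \<gamma>. A \<in> \<A> \<Longrightarrow> \<gamma> \<in> \<Gamma> \<Longrightarrow>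
      emeasure M (sym_diff (aut_image M (T' \<gamma>) A) (aut_image M (T \<gamma>) A)) < ennreal e"
proof -
  obtain t where t: "\<And>v. t v \<in> transf M" "\<And>v. T v = transf_class M (t v)"
    "\<And>v w. AE x in M. t (v + w) x = t v (t w x)" "AE x in M. t 0 x = x"
    using action_representatives[OF T] by blast
  have tm: "t v \<in> measurable M M" for v by (rule transf_measurable[OF t(1)])
  define pre where "pre v A = t v -` A \<inter> space M" for v A
  have pre_sets: "pre v A \<in> sets M" if "A \<in> sets M" for v A
    unfolding pre_def using measurable_sets[OF tm that] .
  have pre_emeasure: "emeasure M (pre v A) = emeasure M A" if "A \<in> sets M" for v A
    unfolding pre_def by (rule emeasure_vimage_transf[OF t(1) that])
  \<comment> \<open>\<open>A0\<close> guarantees that \<open>B\<close> below is not null. The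
    preimage of \<open>A\<close> under \<open>t (- \<gamma>)\<close> is the image of
    \<open>A\<close> under \<open>T \<gamma>\<close> mod 0. The label must see it besides
    \<open>A\<close>: the comparison asks whether the moved point lies in \<open>A\<close> and
    whether the original point lies in that image.\<close>
  define \<F> where "\<F> = insert A0 (\<A> \<union> (\<Union>\<gamma>\<in>\<Gamma>. pre (- \<gamma>) ` \<A>))"
  have \<F>: "finite \<F>" "\<F> \<subseteq> sets M" "\<And>C. C \<in> \<F> \<Longrightarrow> emeasure M C \<noteq> \<infinity>"
    using \<A> \<Gamma> A0 pre_sets pre_emeasure by (auto simp: \<F>_def)
  obtain l :: "'a \<Rightarrow> nat" where l: "l \<in> measurable M (count_space UNIV)"
    "\<And>x y C. l x = l y \<Longrightarrow> C \<in> \<F> \<Longrightarrow> x \<in> C \<longleftrightarrow> y \<in> C" "\<And>x. x \<notin> \<Union>\<F> \<Longrightarrow> l x = 0"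
    using finite_family_label[OF \<F>(1,2)] by blast
  have fin_Un: "emeasure M (\<Union>i\<in>I. F i) \<noteq> \<infinity>"
    if "finite I" "\<And>i. i \<in> I \<Longrightarrow> F i \<in> sets M" "\<And>i. i \<in> I \<Longrightarrow> emeasure M (F i) \<noteq> \<infinity>"
    for I :: "'i set" and F
  proof -
    have "emeasure M (\<Union>i\<in>I. F i) \<le> (\<Sum>i\<in>I. emeasure M (F i))"
      using that by (intro emeasure_subadditive_finite) auto
    also have "\<dots> < \<infinity>" using that by (simp add: less_top)
    finally show ?thesis by simp
  qed
  define U where "U = \<Union>\<F>"
  have U: "U \<in> sets M" "emeasure M U \<noteq> \<infinity>"
    using \<F> fin_Un[of \<F> "\<lambda>C. C"] by (auto simp: U_def intro: sets.finite_Union)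
  define a where "a = measure M U"
  have le_a: "emeasure M A \<le> ennreal a" if "A \<in> \<A>" for A
  proof -
    have "emeasure M A \<le> emeasure M U" using that by (intro emeasure_mono U) (auto simp: U_def \<F>_def)
    then show ?thesis using U(2) by (simp add: a_def emeasure_eq_ennreal_measure)
  qed
  \<comment> \<open>Two boundary errors of at most \<open>\<delta> * a\<close> occur, and
    \<open>2 * \<delta> * a = e * a / (a + 1) < e\<close>; the \<open>+ 1\<close> covers
    \<open>a = 0\<close>.\<close>
  define \<delta> where "\<delta> = e / (2 * (a + 1))"
  have "a \<ge> 0" by (simp add: a_def)
  then have "\<delta> > 0" using e by (simp add: \<delta>_def)
  from cube_boundary_small[OF \<Gamma> this] obtain N :: nat where N: "N > 0"
    "\<And>\<gamma>. \<gamma> \<in> \<Gamma> \<Longrightarrow> real (card {q \<in> cube 0 (int N). q - \<gamma> \<notin> cube 0 (int N)})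
        \<le> \<delta> * real (card (cube 0 (int N) :: (int ^ 'n) set))" by blast
  define Q where "Q = (cube 0 (int N) :: (int ^ 'n) set)"
  have Q: "finite Q" "Q \<noteq> {}" using cube_shift_mem[OF N(1), of 0 0] by (auto simp: Q_def finite_cube)
  \<comment> \<open>\<open>B\<close> has to contain the preimages of \<open>U\<close> under all
    \<open>t q\<close> so that label distributions agree; it stays of finite measure because the
    cube is finite.\<close>
  define B where "B = U \<union> (\<Union>q\<in>Q. pre q U)"
  have B: "B \<in> sets M" "emeasure M B \<noteq> 0" "emeasure M B \<noteq> \<infinity>"
  proof -
    show Bs: "B \<in> sets M" unfolding B_def using U pre_sets Q by auto
    have "emeasure M A0 \<le> emeasure M B"
      using Bs by (intro emeasure_mono) (auto simp: B_def U_def \<F>_def)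
    then show "emeasure M B \<noteq> 0" using A0(2) by auto
    have "emeasure M B \<le> emeasure M U + emeasure M (\<Union>q\<in>Q. pre q U)"
      unfolding B_def using U pre_sets Q by (intro emeasure_subadditive) auto
    also have "\<dots> < \<infinity>"
      using U(2) fin_Un[OF Q(1), of "\<lambda>q. pre q U"] pre_sets pre_emeasure U by (simp add: less_top)
    finally show "emeasure M B \<noteq> \<infinity>" by simp
  qed
  define P where "P = uniform_measure M B"
  define M2 where "M2 = P \<Otimes>\<^sub>M measure_pmf (pmf_of_set Q)"
  have P: "prob_space P" unfolding P_def by (rule prob_space_uniform_measure[OF B(2,3)])
  have sets_P: "sets P = sets M" and space_P: "space P = space M" by (simp_all add: P_def)
  have AE_P: "(AE x in P. R x) \<longleftrightarrow> (AE x in M. x \<in> B \<longrightarrow> R x)" for R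
    unfolding P_def using B by (subst AE_uniform_measure) (auto simp: top.not_eq_extremum)
  define l2 where "l2 z = (if snd z \<in> Q then l (t (snd z) (fst z)) else 0)" for z
  have UB: "U \<subseteq> B" "x \<notin> U \<Longrightarrow> l x = 0" "q \<in> Q \<Longrightarrow> t q -` U \<inter> space M \<subseteq> B" for x q
    using l(3) by (auto simp: B_def U_def pre_def)
  have l2: "l2 \<in> measurable M2 (count_space UNIV)"
    "measure P {x \<in> space P. l x \<le> s} = measure M2 {z \<in> space M2. l2 z \<le> s}" for s
    unfolding l2_def[abs_def] M2_def P_def
    by (rule cyclic_model_labels[where t = t and U = U, OF B Q t(1) l(1) UB]; assumption)+
  have lP: "l \<in> measurable P (count_space UNIV)" using l(1) unfolding measurable_cong_sets[OF sets_P refl] .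
  obtain h k where hk: "h \<in> measurable P M2" "k \<in> measurable M2 P"
    "distr P M2 h = M2" "distr M2 P k = P"
    "AE x in P. k (h x) = x" "AE z in M2. h (k z) = z" "AE x in P. l2 (h x) = l x"
    using cyclic_model_iso[OF M B Q, folded P_def, folded M2_def, OF lP l2] .
  define s where "s v x = k (shift_snd N v (h x))" for v x
  note action = cyclic_model_action[OF P N(1) hk(1,3,2,4,5,6)[unfolded M2_def Q_def], folded s_def,
      folded Q_def]
  define T' where "T' v = transf_class M (extend_by_id B (s v))" for v
  have ext: "extend_by_id B (s v) \<in> transf M" for v
    using extend_by_id_transf[OF B] action(1) unfolding P_def by blast
  have ext_add: "AE x in M. extend_by_id B (s (v + w)) x = extend_by_id B (s v) (extend_by_id B (s w) x)" for v w
  proof -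
    have "AE x in P. s v (s w x) = s (v + w) x" using action(2)[of v w] by eventually_elim simp
    from extend_by_id_comp_AE[OF B action(1)[unfolded P_def] this[unfolded P_def]]
    show ?thesis by eventually_elim simp
  qed
  have zero: "AE x in M. extend_by_id B (s 0) x = x"
    using action(3) unfolding AE_P by eventually_elim (simp add: extend_by_id_def)
  have pull: "AE x in P. R (h x)" if "AE z in M2. R z" for R
    by (rule AE_distr_eqD[OF hk(1,3) that])
  have shift: "shift_snd N v \<in> measurable M2 M2" "distr M2 M2 (shift_snd N v) = M2" for v
    unfolding M2_def Q_def by (rule distr_shift_snd[OF P N(1)])+
  \<comment> \<open>Reading the label identity at \<open>k z\<close> shows that \<open>k\<close>
    respects labels as well; so \<open>s v x\<close> carries the label of the shifted model
    point.\<close>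
  have "AE z in M2. l2 (h (k z)) = l (k z)" by (rule AE_distr_eqD[OF hk(2,4,7)])
  then have "AE z in M2. l (k z) = l2 z" using hk(6) by eventually_elim simp
  then have label: "AE x in P. l (s v x) = l2 (shift_snd N v (h x))" for v
    unfolding s_def by (intro pull AE_distr_eqD[OF shift])
  have fst_M2: "fst \<in> measurable M2 P" "distr M2 P fst = P"
    unfolding M2_def by (rule measurable_fst, rule prob_space.distr_pair_fst[OF prob_space_measure_pmf])
  \<comment> \<open>The vector \<open>q\<close> will be \<open>snd (h x)\<close> and varies with
    \<open>x\<close>, so one null set must serve all \<open>q\<close>; the lattice is
    countable.\<close>
  have "AE y in P. \<forall>q. t (v + q) y = t v (t q y)" for v
    unfolding AE_all_countable AE_P
  proof
    show "AE y in M. y \<in> B \<longrightarrow> t (v + q) y = t v (t q y)" for q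
      using t(3)[of v q] by eventually_elim simp
  qed
  then have comp: "AE x in P. \<forall>q. t (v + q) (fst (h x)) = t v (t q (fst (h x)))" for v
    by (intro pull AE_distr_eqD[OF fst_M2])
  show ?thesis
  proof (rule that[of T' N])
    show "T' \<in> actions M" unfolding T'_def[abs_def] by (rule action_from_transf[OF ext ext_add])
    show "N > 0" by (rule N(1))
    show "T' (\<chi> i. int N * v $ i) = \<one>\<^bsub>aut_group M\<^esub>" for v
    proof -
      have "s (\<chi> i. int N * v $ i) = s 0" using action(4) by blast
      then show ?thesis
        unfolding T'_def aut_one using zero by (intro transf_class_cong) simp
    qed
    fix A \<gamma> assume A: "A \<in> \<A>" and \<gamma>: "\<gamma> \<in> \<Gamma>"
    have As: "A \<in> sets M" using A \<A>(2) by blast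
    let ?A' = "pre (- \<gamma>) A"
    have in_\<F>: "A \<in> \<F>" "?A' \<in> \<F>" using A \<gamma> by (auto simp: \<F>_def)
    define W where "W = {q \<in> Q. q - \<gamma> \<notin> Q}"
    have W: "W \<subseteq> Q" "real (card W) \<le> \<delta> * real (card Q)"
      using N(2)[OF \<gamma>] by (auto simp: W_def Q_def)
    define X where "X D = {x \<in> B. snd (h x) \<in> W \<and> fst (h x) \<in> D (snd (h x))}" for D
    have X: "X D \<in> sets M" "emeasure M (X D) \<le> ennreal (\<delta> * a)"
      if D: "\<And>q. D q \<in> sets M" "\<And>q. emeasure M (D q) \<le> ennreal a" for D
      unfolding X_def
      using cyclic_model_emeasure_le[OF B Q W hk(1,3)[unfolded M2_def P_def], of D a] D \<open>a \<ge> 0\<close> by blast+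
    \<comment> \<open>In model coordinates, \<open>?D1\<close> says that the periodic map at
      \<open>- \<gamma>\<close> lands in \<open>A\<close>, and \<open>?D2\<close> that
      \<open>t (- \<gamma>)\<close> does. They agree unless \<open>q - \<gamma>\<close> leaves the
      cube, so every disagreement lies over \<open>W\<close> and satisfies one of the two
      conditions.\<close>
    let ?D1 = "\<lambda>q. pre (cube_shift N (- \<gamma>) q) A" and ?D2 = "\<lambda>q. pre q ?A'"
    have X1: "X ?D1 \<in> sets M" "emeasure M (X ?D1) \<le> ennreal (\<delta> * a)"
      using X[of ?D1] As pre_sets pre_emeasure le_a[OF A] by auto
    have X2: "X ?D2 \<in> sets M" "emeasure M (X ?D2) \<le> ennreal (\<delta> * a)"
      using X[of ?D2] As pre_sets pre_emeasure le_a[OF A] by auto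
    let ?S = "sym_diff (aut_image M (T' \<gamma>) A) (aut_image M (T \<gamma>) A)"
    have "AE x in M. x \<in> ?S \<longrightarrow> x \<in> X ?D1 \<union> X ?D2"
      using aut_image_action_AE[OF ext ext_add, of \<gamma> A] aut_image_action_AE[OF t(1,3), of \<gamma> A] AE_space
        label[of "- \<gamma>", unfolded AE_P] hk(7)[unfolded AE_P] comp[of "- \<gamma>", unfolded AE_P]
        action(5)[unfolded AE_P]
    proof eventually_elim
      case (elim x)
      have im: "x \<in> aut_image M (T' \<gamma>) A \<longleftrightarrow> extend_by_id B (s (- \<gamma>)) x \<in> A"
        "x \<in> aut_image M (T \<gamma>) A \<longleftrightarrow> x \<in> ?A'"
        using elim(1-3) by (simp_all add: T'_def t(2) pre_def)
      show ?case
      proof (cases "x \<in> B")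
        case False
        \<comment> \<open>Both sets belong to the family whose union is \<open>U\<close>, hence lie
          in \<open>B\<close>; outside \<open>B\<close> the extension by the identity causes no
          error.\<close>
        then have "x \<notin> A" "x \<notin> ?A'" using in_\<F> by (auto simp: B_def U_def)
        then show ?thesis using False im by (simp add: extend_by_id_def)
      next
        case True
        define y q where "y = fst (h x)" and "q = snd (h x)"
        have q: "q \<in> Q" using elim(7) True by (simp add: q_def)
        have "h x \<in> space M2" using measurable_space[OF hk(1)] elim(3) by (simp add: space_P)
        then have y: "y \<in> space M" by (auto simp: M2_def space_pair_measure space_P y_def)
        have ty: "t v y \<in> space M" for v by (rule measurable_space[OF tm y])
        have shifted: "cube_shift N (- \<gamma>) q \<in> Q" unfolding Q_def by (rule cube_shift_mem[OF N(1)])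
        have "l (s (- \<gamma>) x) = l (t (cube_shift N (- \<gamma>) q) y)"
          using elim(4) True shifted by (simp add: l2_def shift_snd_def y_def q_def)
        from l(2)[OF this in_\<F>(1)]
        have 1: "extend_by_id B (s (- \<gamma>)) x \<in> A \<longleftrightarrow> y \<in> ?D1 q"
          using True y by (simp add: extend_by_id_def pre_def)
        have "l x = l (t q y)" using elim(5) True q by (simp add: l2_def y_def q_def)
        from l(2)[OF this in_\<F>(2)]
        have 2: "x \<in> ?A' \<longleftrightarrow> y \<in> ?D2 q" using y by (simp add: pre_def)
        \<comment> \<open>When the translation stays in the cube there is no reduction modulo
          \<open>N\<close>, and the action law turns the shift of \<open>q\<close> into an
          application of \<open>t (- \<gamma>)\<close>.\<close>
        have 3: "y \<in> ?D1 q \<longleftrightarrow> y \<in> ?D2 q" if "q - \<gamma> \<in> Q"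
        proof -
          have "cube_shift N (- \<gamma>) q = - \<gamma> + q" using that cube_shift_eq[of q "- \<gamma>" N] by (simp add: Q_def)
          then show ?thesis using elim(6) True y ty by (simp add: pre_def y_def)
        qed
        show ?thesis
          using im 1 2 3 q True by (auto simp: X_def W_def y_def q_def)
      qed
    qed
    then have "emeasure M ?S \<le> emeasure M (X ?D1 \<union> X ?D2)"
      by (rule emeasure_mono_AE) (use X1 X2 in blast)
    also have "\<dots> \<le> ennreal (\<delta> * a) + ennreal (\<delta> * a)"
      by (rule order_trans[OF emeasure_subadditive[OF X1(1) X2(1)] add_mono[OF X1(2) X2(2)]])
    also have "\<dots> = ennreal (2 * \<delta> * a)"
      using \<open>a \<ge> 0\<close> \<open>\<delta> > 0\<close> by (simp add: ennreal_plus[symmetric] del: ennreal_plus)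
    also have "2 * \<delta> * a < e" using \<open>a \<ge> 0\<close> e by (simp add: \<delta>_def field_simps)
    then have "ennreal (2 * \<delta> * a) < ennreal e" using e by (simp add: ennreal_lessI)
    finally show "emeasure M ?S < ennreal e" .
  qed
qed

section \<open>A countable dense family of sets\<close>

text \<open>Regularity squeezes \<open>S\<close> between a compact \<open>K\<close> and an open
  \<open>V\<close> whose measures differ by less than \<open>e\<close>. Finitely many basic sets
  inside \<open>V\<close> cover \<open>K\<close>, and the symmetric difference with their union lies
  in \<open>V - K\<close>.\<close>

lemma finite_borel_approx_basis:
  fixes \<nu> :: "real measure"
  assumes \<nu>: "sets \<nu> = sets borel" "finite_measure \<nu>" and \<B>: "topological_basis \<B>"
    and S: "S \<in> sets borel" and "e > 0"
  obtains \<D> where "finite \<D>" "\<D> \<subseteq> \<B>" "measure \<nu> (sym_diff S (\<Union>\<D>)) < e"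
proof -
  interpret finite_measure \<nu> by fact
  have fin: "emeasure \<nu> (space \<nu>) \<noteq> \<infinity>" by simp
  have "\<exists>K. K \<subseteq> S \<and> compact K \<and> measure \<nu> S - e / 2 < measure \<nu> K"
  proof (rule ccontr)
    assume "\<nexists>K. K \<subseteq> S \<and> compact K \<and> measure \<nu> S - e / 2 < measure \<nu> K"
    then have *: "measure \<nu> K \<le> measure \<nu> S - e / 2" if "K \<subseteq> S" "compact K" for K
      using that by (meson not_less)
    have "emeasure \<nu> S \<le> ennreal (measure \<nu> S - e / 2)"
      unfolding inner_regular[OF \<nu>(1) fin S]
      by (rule SUP_least) (use * in \<open>auto simp: emeasure_eq_measure intro: ennreal_leI\<close>)
    then have "measure \<nu> S \<le> measure \<nu> S - e / 2"
      using *[of "{}"] by (simp add: emeasure_eq_measure)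
    then show False using \<open>e > 0\<close> by simp
  qed
  then obtain K where K: "K \<subseteq> S" "compact K" "measure \<nu> S - e / 2 < measure \<nu> K" by blast
  have "\<exists>V. S \<subseteq> V \<and> open V \<and> measure \<nu> V < measure \<nu> S + e / 2"
  proof (rule ccontr)
    assume "\<nexists>V. S \<subseteq> V \<and> open V \<and> measure \<nu> V < measure \<nu> S + e / 2"
    then have *: "measure \<nu> S + e / 2 \<le> measure \<nu> V" if "S \<subseteq> V" "open V" for V
      using that by (meson not_less)
    have "ennreal (measure \<nu> S + e / 2) \<le> emeasure \<nu> S"
      unfolding outer_regular[OF \<nu>(1) fin S]
      by (rule INF_greatest) (use * in \<open>auto simp: emeasure_eq_measure intro: ennreal_leI\<close>)
    then have "measure \<nu> S + e / 2 \<le> measure \<nu> S" by (simp add: emeasure_eq_measure)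
    then show False using \<open>e > 0\<close> by simp
  qed
  then obtain V where V: "S \<subseteq> V" "open V" "measure \<nu> V < measure \<nu> S + e / 2" by blast
  obtain \<B>' where \<B>': "\<B>' \<subseteq> \<B>" "\<Union>\<B>' = V" using \<B> V(2) unfolding topological_basis_def by metis
  have "\<And>T. T \<in> \<B>' \<Longrightarrow> open T" using \<B>' \<B> topological_basis_open by blast
  then obtain \<D> where \<D>: "\<D> \<subseteq> \<B>'" "finite \<D>" "K \<subseteq> \<Union>\<D>"
    using compactE[OF K(2), of \<B>'] K(1) V(1) \<B>'(2) by (metis order_trans)
  have KV: "K \<in> sets \<nu>" "V \<in> sets \<nu>" using K(2) V(2) \<nu>(1) by (auto simp: compact_imp_closed)
  have "measure \<nu> (sym_diff S (\<Union>\<D>)) \<le> measure \<nu> (V - K)"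
    by (rule finite_measure_mono) (use K(1) V(1) \<D> \<B>'(2) KV in auto)
  also have "\<dots> = measure \<nu> V - measure \<nu> K"
    by (rule finite_measure_Diff) (use KV K(1) V(1) in auto)
  also have "\<dots> < e" using K(3) V(3) by simp
  finally show ?thesis using that \<D> \<B>'(1) by blast
qed

text \<open>This makes the measure algebra separable, so countably many conditions can express
  closeness to the identity on all sets of finite measure.\<close>

lemma countable_dense_sets:
  fixes M :: "'a measure"
  assumes M: "standard_borel M" "sigma_finite_measure M"
  obtains A :: "nat \<Rightarrow> 'a set" where "\<And>i. A i \<in> sets M" "\<And>i. emeasure M (A i) \<noteq> \<infinity>"
    "\<And>C e. C \<in> sets M \<Longrightarrow> emeasure M C \<noteq> \<infinity> \<Longrightarrow> 0 < e \<Longrightarrow> \<exists>i. emeasure M (sym_diff C (A i)) < ennreal e"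
proof (cases "space M = {}")
  case True
  then have empty: "C = {}" if "C \<in> sets M" for C using sets.sets_into_space[OF that] by simp
  have "\<exists>i::nat. emeasure M (sym_diff C {}) < ennreal e" if "C \<in> sets M" "0 < e" for C e
    unfolding empty[OF that(1)] using that(2) by simp
  then show ?thesis by (intro that[of "\<lambda>_. {}"]) simp_all
next
  case False
  from standard_borel_code[OF M(1) this] obtain f :: "'a \<Rightarrow> real" and g
    where f: "f \<in> borel_measurable M" and g: "g \<in> measurable borel M"
      and gf: "\<And>x. x \<in> space M \<Longrightarrow> g (f x) = x" by blast
  obtain X :: "nat \<Rightarrow> 'a set" where X: "range X \<subseteq> sets M" "(\<Union>i. X i) = space M"
    "\<And>i. emeasure M (X i) \<noteq> \<infinity>" "incseq X"
    using sigma_finite_measure.sigma_finite_incseq[OF M(2)] by metis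
  have Xs: "X n \<in> sets M" for n using X(1) by blast
  obtain \<B> :: "real set set" where \<B>: "countable \<B>" "topological_basis \<B>"
    using ex_countable_basis by blast
  have \<B>s: "D \<in> sets borel" if "D \<in> \<B>" for D using topological_basis_open[OF \<B>(2) that] by simp
  \<comment> \<open>Finite unions from a countable basis are countable in number; they are pulled
    back by the code and cut by an exhaustion of finite measure.\<close>
  define F where "F = (\<lambda>(\<D>, n). X n \<inter> (f -` (\<Union>\<D>) \<inter> space M))"
  define \<K> where "\<K> = F ` ({\<D>. finite \<D> \<and> \<D> \<subseteq> \<B>} \<times> UNIV)"
  have "countable \<K>"
    unfolding \<K>_def using countable_Collect_finite_subset[OF \<B>(1)] by (intro countable_image countable_SIGMA) auto
  have "\<K> \<noteq> {}" by (auto simp: \<K>_def)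
  have F: "F (\<D>, n) \<in> sets M" "emeasure M (F (\<D>, n)) \<noteq> \<infinity>" if "finite \<D>" "\<D> \<subseteq> \<B>" for \<D> n
  proof -
    have "\<Union>\<D> \<in> sets borel" using that \<B>s by (intro sets.finite_Union) auto
    then show "F (\<D>, n) \<in> sets M" using measurable_sets[OF f, of "\<Union>\<D>"] Xs by (auto simp: F_def)
    have "emeasure M (F (\<D>, n)) \<le> emeasure M (X n)" using Xs by (intro emeasure_mono) (auto simp: F_def)
    then show "emeasure M (F (\<D>, n)) \<noteq> \<infinity>" using X(3)[of n] by (auto simp: top_unique)
  qed
  show ?thesis
  proof (rule that[of "from_nat_into \<K>"])
    show "from_nat_into \<K> i \<in> sets M" "emeasure M (from_nat_into \<K> i) \<noteq> \<infinity>" for i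
      using from_nat_into[OF \<open>\<K> \<noteq> {}\<close>, of i] F by (auto simp: \<K>_def)
    fix C and e :: real assume C: "C \<in> sets M" "emeasure M C \<noteq> \<infinity>" and "0 < e"
    have "(\<lambda>n. emeasure M (C - X n)) \<longlonglongrightarrow> emeasure M (\<Inter>n. C - X n)"
    proof (rule Lim_emeasure_decseq)
      show "range (\<lambda>n. C - X n) \<subseteq> sets M" using C(1) Xs by auto
      show "decseq (\<lambda>n. C - X n)" using X(4) by (auto simp: decseq_def incseq_def)
      have "emeasure M (C - X n) \<le> emeasure M C" for n using C(1) by (intro emeasure_mono) auto
      then show "emeasure M (C - X n) \<noteq> \<infinity>" for n using C(2) by (metis infinity_ennreal_def top_unique)
    qed
    moreover have "(\<Inter>n. C - X n) = {}" using X(2) sets.sets_into_space[OF C(1)] by blast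
    ultimately have "(\<lambda>n. emeasure M (C - X n)) \<longlonglongrightarrow> 0" by (simp only: emeasure_empty)
    then have "\<forall>\<^sub>F n in sequentially. emeasure M (C - X n) < ennreal (e / 2)"
      using \<open>0 < e\<close> by (intro order_tendstoD) auto
    then obtain n where n: "emeasure M (C - X n) < ennreal (e / 2)"
      using eventually_happens trivial_limit_sequentially by blast
    define \<nu> where "\<nu> = distr (restrict_space M (X n)) borel f"
    have fr: "f \<in> borel_measurable (restrict_space M (X n))" using f by (rule measurable_restrict_space1)
    have \<nu>: "emeasure \<nu> E = emeasure M (X n \<inter> (f -` E \<inter> space M))" if "E \<in> sets borel" for E
    proof -
      have "f -` E \<inter> space (restrict_space M (X n)) = X n \<inter> (f -` E \<inter> space M)"
        by (auto simp: space_restrict_space)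
      then show ?thesis
        unfolding \<nu>_def using that Xs
        by (simp add: emeasure_distr[OF fr] emeasure_restrict_space)
    qed
    have fin: "finite_measure \<nu>"
    proof
      have "emeasure M (X n \<inter> (f -` UNIV \<inter> space M)) \<le> emeasure M (X n)" using Xs by (intro emeasure_mono) auto
      then show "emeasure \<nu> (space \<nu>) \<noteq> \<infinity>"
        using X(3)[of n] \<nu>[of UNIV] by (auto simp: \<nu>_def top_unique)
    qed
    \<comment> \<open>Since \<open>g\<close> decodes \<open>f\<close>, the set \<open>C\<close> is
      the preimage of this Borel set under \<open>f\<close>; approximating it for
      \<open>\<nu>\<close> approximates \<open>C\<close> within \<open>X n\<close>.\<close>
    have S: "g -` C \<in> sets borel" using measurable_sets[OF g C(1)] by simp
    obtain \<D> where \<D>: "finite \<D>" "\<D> \<subseteq> \<B>" "measure \<nu> (sym_diff (g -` C) (\<Union>\<D>)) < e / 2"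
      using finite_borel_approx_basis[OF _ fin \<B>(2) S, of "e / 2"] \<open>0 < e\<close> by (auto simp: \<nu>_def)
    have D: "\<Union>\<D> \<in> sets borel" using \<D> \<B>s by (intro sets.finite_Union) auto
    have "sym_diff C (F (\<D>, n)) \<subseteq> (C - X n) \<union> (X n \<inter> (f -` sym_diff (g -` C) (\<Union>\<D>) \<inter> space M))"
      using gf sets.sets_into_space[OF C(1)] by (auto simp: F_def)
    moreover have sd: "X n \<inter> (f -` sym_diff (g -` C) (\<Union>\<D>) \<inter> space M) \<in> sets M"
      using measurable_sets[OF f, of "sym_diff (g -` C) (\<Union>\<D>)"] S D Xs by auto
    ultimately have "emeasure M (sym_diff C (F (\<D>, n)))
        \<le> emeasure M (C - X n) + emeasure M (X n \<inter> (f -` sym_diff (g -` C) (\<Union>\<D>) \<inter> space M))"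
      using C(1) Xs by (intro order_trans[OF emeasure_mono emeasure_subadditive]) auto
    also have "emeasure M (X n \<inter> (f -` sym_diff (g -` C) (\<Union>\<D>) \<inter> space M))
        = ennreal (measure \<nu> (sym_diff (g -` C) (\<Union>\<D>)))"
      using \<nu>[of "sym_diff (g -` C) (\<Union>\<D>)"] S D finite_measure.emeasure_eq_measure[OF fin] by auto
    also have "emeasure M (C - X n) + \<dots> < ennreal (e / 2) + ennreal (e / 2)"
      using n \<D>(3) \<open>0 < e\<close> by (intro add_strict_mono) (auto simp: ennreal_lessI)
    also have "\<dots> = ennreal e" using \<open>0 < e\<close> by (simp add: ennreal_plus[symmetric] del: ennreal_plus)
    finally have "emeasure M (sym_diff C (F (\<D>, n))) < ennreal e" .
    moreover have "F (\<D>, n) \<in> \<K>" using \<D> by (auto simp: \<K>_def)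
    then obtain i where "from_nat_into \<K> i = F (\<D>, n)" using from_nat_into_surj[OF \<open>countable \<K>\<close>] by blast
    ultimately show "\<exists>i. emeasure M (sym_diff C (from_nat_into \<K> i)) < ennreal e" by metis
  qed
qed

section \<open>Lattice points near lines\<close>

text \<open>Simultaneous approximation of a direction vector \<open>u\<close> yields an integer
  vector near \<open>q * u\<close>, which is then dilated by \<open>N\<close>. Its accuracy
  \<open>1 / m\<close> and the bound on \<open>q\<close> are fixed before the line is chosen, hence
  the uniform \<open>R\<close>.\<close>

lemma dirichlet_line:
  fixes N :: nat
  assumes "e > 0"
  obtains R :: int where "\<And>\<theta> :: (real ^ 'n::finite) set. \<theta> \<in> lines \<Longrightarrow>
    \<exists>\<gamma>. \<gamma> \<noteq> 0 \<and> (\<forall>i. \<bar>\<gamma> $ i\<bar> \<le> R) \<and> (\<exists>g\<in>\<theta>. dist (lattice_point (\<chi> i. int N * \<gamma> $ i)) g < e)"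
proof -
  define n where "n = CARD('n)"
  \<comment> \<open>Dilation by \<open>N\<close> and the passage to the Euclidean norm through the
    sum of \<open>n\<close> coordinates cost a factor \<open>n * N\<close>, which
    \<open>1 / m\<close> must absorb.\<close>
  obtain m :: nat where "max 1 (real n * real N / e) < real m"
    using reals_Archimedean2 by blast
  then have m: "m > 0" "real n * real N / e < real m" by auto
  \<comment> \<open>Each coordinate of the vector found is within 1 of that of \<open>q * u\<close>,
    where \<open>u\<close> has coordinates at most 1 in absolute value and
    \<open>q \<le> m ^ n\<close>; this gives \<open>m ^ n + 1\<close>.\<close>
  show ?thesis
  proof (rule that[of "int (m ^ n) + 1"])
    fix \<theta> :: "(real ^ 'n) set" assume "\<theta> \<in> lines"
    then have \<theta>: "subspace \<theta>" "dim \<theta> = 1" by (auto simp: lines_def)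
    have "\<not> \<theta> \<subseteq> {0}" using \<theta>(2) dim_eq_0[of \<theta>] by auto
    then obtain v where v: "v \<in> \<theta>" "v \<noteq> 0" by blast
    \<comment> \<open>Dividing by a coordinate of largest modulus gives \<open>u\<close> with
      \<open>u $ j = 1\<close> and all coordinates bounded by 1. The exact 1 will force the
      approximating vector to be nonzero.\<close>
    have "Max (range (\<lambda>i. \<bar>v $ i\<bar>)) \<in> range (\<lambda>i. \<bar>v $ i\<bar>)" by (intro Max_in) auto
    then obtain j where j: "Max (range (\<lambda>i. \<bar>v $ i\<bar>)) = \<bar>v $ j\<bar>" by (rule rangeE)
    have max: "\<bar>v $ i\<bar> \<le> \<bar>v $ j\<bar>" for i unfolding j[symmetric] by (intro Max_ge) auto
    have vj: "v $ j \<noteq> 0"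
    proof
      assume "v $ j = 0"
      then have "v $ i = 0" for i using max[of i] by simp
      then show False using v(2) by (simp add: vec_eq_iff)
    qed
    define u where "u = (1 / v $ j) *\<^sub>R v"
    have u: "u \<in> \<theta>" "u $ j = 1" "\<bar>u $ i\<bar> \<le> 1" for i
      using \<theta>(1) v(1) vj max[of i] by (auto simp: u_def subspace_scale abs_mult)
    obtain f where f: "bij_betw f {0..<n} (UNIV :: 'n set)"
      unfolding n_def using ex_bij_betw_nat_finite[of "UNIV :: 'n set"] by auto
    obtain q p where qp: "0 < q" "q \<le> int (m ^ n)"
      "\<And>k. k < n \<Longrightarrow> \<bar>of_int q * u $ f k - of_int (p k)\<bar> < 1 / m"
      using Dirichlet_approx_simult[OF m(1), of n "\<lambda>k. u $ f k"] by blast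
    define \<gamma> where "\<gamma> = (\<chi> i. p (inv_into {0..<n} f i))"
    have \<gamma>: "\<bar>of_int q * u $ i - of_int (\<gamma> $ i)\<bar> < 1 / m" for i
    proof -
      have "inv_into {0..<n} f i \<in> {0..<n}" "f (inv_into {0..<n} f i) = i"
        using f inv_into_into[of i f "{0..<n}"] f_inv_into_f[of i f "{0..<n}"] by (auto simp: bij_betw_def)
      then show ?thesis using qp(3)[of "inv_into {0..<n} f i"] by (simp add: \<gamma>_def)
    qed
    have m1: "1 / real m \<le> 1" using m(1) by simp
    \<comment> \<open>Two integers at distance below 1 coincide, so coordinate \<open>j\<close>
      equals the positive \<open>q\<close>.\<close>
    have "\<bar>real_of_int q - of_int (\<gamma> $ j)\<bar> < 1" using \<gamma>[of j] u(2) m1 by simp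
    then have "\<gamma> $ j = q" by linarith
    then have "\<gamma> \<noteq> 0" using qp(1) by auto
    moreover have "\<bar>\<gamma> $ i\<bar> \<le> int (m ^ n) + 1" for i
    proof -
      have "\<bar>real_of_int q * u $ i\<bar> \<le> real_of_int q" using u(3)[of i] qp(1) by (simp add: abs_mult mult_left_le)
      then have "\<bar>real_of_int (\<gamma> $ i)\<bar> \<le> real_of_int q + 1" using \<gamma>[of i] m1 by linarith
      then have "\<bar>\<gamma> $ i\<bar> \<le> q + 1" by linarith
      then show ?thesis using qp(2) by linarith
    qed
    moreover have "dist (lattice_point (\<chi> i. int N * \<gamma> $ i)) ((real N * of_int q) *\<^sub>R u) < e"
    proof -
      let ?d = "lattice_point (\<chi> i. int N * \<gamma> $ i) - (real N * of_int q) *\<^sub>R u"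
      have "\<bar>?d $ i\<bar> \<le> real N * (1 / m)" for i
      proof -
        have "?d $ i = - (real N * (of_int q * u $ i - of_int (\<gamma> $ i)))"
          by (simp add: lattice_point_def algebra_simps)
        then have "\<bar>?d $ i\<bar> = real N * \<bar>of_int q * u $ i - of_int (\<gamma> $ i)\<bar>" by (simp add: abs_mult)
        then show ?thesis using \<gamma>[of i] by (simp only:) (intro mult_left_mono, auto)
      qed
      then have "(\<Sum>i\<in>UNIV. \<bar>?d $ i\<bar>) \<le> (\<Sum>i\<in>(UNIV :: 'n set). real N * (1 / m))" by (intro sum_mono) blast
      then have "norm ?d \<le> real n * (real N * (1 / m))"
        using norm_le_l1_cart[of ?d] by (simp add: n_def)
      also have "\<dots> < e" using m assms by (simp add: field_simps)
      finally show ?thesis by (simp add: dist_norm)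
    qed
    moreover have "(real N * of_int q) *\<^sub>R u \<in> \<theta>" using \<theta>(1) u(1) by (rule subspace_scale)
    ultimately show "\<exists>\<gamma>. \<gamma> \<noteq> 0 \<and> (\<forall>i. \<bar>\<gamma> $ i\<bar> \<le> int (m ^ n) + 1) \<and>
        (\<exists>g\<in>\<theta>. dist (lattice_point (\<chi> i. int N * \<gamma> $ i)) g < e)" by blast
  qed
qed

section \<open>Residuality\<close>

text \<open>The chosen representative depends on \<open>R\<close> alone, so images of different sets
  are preimages under one map and Boolean identities hold exactly, not just mod 0.\<close>

lemma aut_image_vimage:
  assumes "R \<in> carrier (aut_group M)"
  obtains g where "g \<in> transf M" "\<And>A. aut_image M R A = g -` A \<inter> space M"
proof -
  have "inv\<^bsub>aut_group M\<^esub> R \<in> carrier (aut_group M)"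
    using group.inv_closed[OF group_aut_group assms(1)] .
  then obtain f where "f \<in> transf M" "inv\<^bsub>aut_group M\<^esub> R = transf_class M f"
    by (auto simp: aut_carrier)
  then show ?thesis
    using that[of "SOME g. g \<in> inv\<^bsub>aut_group M\<^esub> R"] transf_class_some(1) unfolding aut_image_def by metis
qed

lemma emeasure_sym_diff_aut_image:
  assumes "R \<in> carrier (aut_group M)" "A \<in> sets M" "B \<in> sets M"
  shows "emeasure M (sym_diff (aut_image M R A) (aut_image M R B)) = emeasure M (sym_diff A B)"
proof -
  obtain g where g: "g \<in> transf M" "\<And>A. aut_image M R A = g -` A \<inter> space M"
    by (rule aut_image_vimage[OF assms(1)]) (rule that)
  have "sym_diff (g -` A \<inter> space M) (g -` B \<inter> space M) = g -` sym_diff A B \<inter> space M" by auto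
  then show ?thesis using emeasure_vimage_transf[OF g(1), of "sym_diff A B"] assms(2,3) by (simp add: g(2))
qed

lemma aut_image_one_AE: "AE x in M. x \<in> aut_image M \<one>\<^bsub>aut_group M\<^esub> A \<longleftrightarrow> x \<in> A"
  unfolding aut_one using aut_image_AE[OF transf_id(1) transf_id(1), of M A] by simp

text \<open>The representative chosen from the identity class may move points of a null set, so the
  image of \<open>A\<close> agrees with \<open>A\<close> only mod 0.\<close>

lemma emeasure_aut_image_one_sym_diff:
  assumes "A \<in> sets M"
  shows "emeasure M (sym_diff (aut_image M \<one>\<^bsub>aut_group M\<^esub> A) A) = 0"
proof -
  have "aut_image M \<one>\<^bsub>aut_group M\<^esub> A \<in> sets M"
    using aut_image_sets[OF group.is_monoid[OF group_aut_group, THEN monoid.one_closed] assms] .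
  then have "sym_diff (aut_image M \<one>\<^bsub>aut_group M\<^esub> A) A \<in> sets M" (is "?D \<in> _") using assms by blast
  moreover from this have "{x \<in> space M. \<not> x \<notin> ?D} = ?D" using sets.sets_into_space by blast
  moreover have "AE x in M. x \<notin> ?D"
    using aut_image_one_AE[of M A] by eventually_elim blast
  ultimately show ?thesis using AE_iff_measurable[of ?D M "\<lambda>x. x \<notin> ?D"] by blast
qed

section \<open>Open sets and convergent sequences in the space of actions\<close>

lemma action_carrier: "T \<in> actions M \<Longrightarrow> T v \<in> carrier (aut_group M)"
  by (auto simp: actions_def hom_def lattice_group_def)

lemma action_inv:
  assumes "T \<in> actions M"
  shows "inv\<^bsub>aut_group M\<^esub> (T v) = T (- v)"
proof -
  obtain t where t: "\<And>v. t v \<in> transf M" "\<And>v. T v = transf_class M (t v)"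
    "\<And>v w. AE x in M. t (v + w) x = t v (t w x)" "AE x in M. t 0 x = x"
    using action_representatives[OF assms] by blast
  have "AE x in M. t (- v) (t v x) = x" using t(3)[of "- v" v] t(4) by eventually_elim simp
  then show ?thesis unfolding t(2) by (intro aut_inv t(1))
qed

lemma topspace_action_topology: "topspace (action_topology M) = actions M"
  unfolding action_topology_def topspace_subtopology topspace_product_topology topspace_weak_topology
  by (auto simp: PiE_iff action_carrier)

lemma openin_action_ball:
  assumes "R \<in> carrier (aut_group M)" "A \<in> sets M" "emeasure M A < \<infinity>" "e > 0"
  shows "openin (action_topology M)
    {T \<in> actions M. emeasure M (sym_diff (aut_image M (T v) A) (aut_image M R A)) < ennreal e}"
proof -
  let ?O = "{S \<in> carrier (aut_group M). emeasure M (sym_diff (aut_image M S A) (aut_image M R A)) < ennreal e}"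
  let ?P = "product_topology (\<lambda>_. weak_topology M) UNIV"
  have "openin (weak_topology M) ?O"
    unfolding weak_topology_def using assms by (intro topology_generated_by_Basis) blast
  then have "openin ?P {T \<in> topspace ?P. T v \<in> ?O}"
    by (rule openin_continuous_map_preimage[rotated])
      (rule continuous_map_product_projection[where X = "\<lambda>_. weak_topology M", OF UNIV_I])
  then have "openin (action_topology M) ({T \<in> topspace ?P. T v \<in> ?O} \<inter> actions M)"
    unfolding action_topology_def by (rule openin_subtopology_Int)
  moreover have "{T \<in> topspace ?P. T v \<in> ?O} \<inter> actions M
      = {T \<in> actions M. emeasure M (sym_diff (aut_image M (T v) A) (aut_image M R A)) < ennreal e}"
    by (auto simp: topspace_product_topology topspace_weak_topology PiE_iff action_carrier)
  ultimately show ?thesis by simp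
qed

text \<open>The inverse of the value at \<open>v\<close> is the value at \<open>- v\<close>, so
  convergence of images at every vector already contains the convergence for inverses.\<close>

lemma limitin_action_topology:
  fixes S :: "nat \<Rightarrow> int ^ 'n::finite \<Rightarrow> ('a \<Rightarrow> 'a) set"
  assumes S: "\<And>n. S n \<in> actions M" and T: "T \<in> actions M"
    and lim: "\<And>v A. A \<in> sets M \<Longrightarrow> emeasure M A < \<infinity> \<Longrightarrow>
      (\<lambda>n. emeasure M (sym_diff (aut_image M (S n v) A) (aut_image M (T v) A))) \<longlonglongrightarrow> 0"
  shows "limitin (action_topology M) S T sequentially"
proof -
  have "limitin (weak_topology M) (\<lambda>n. S n v) (T v) sequentially" for v
    unfolding limitin_weak_topology[OF action_carrier[OF S] action_carrier[OF T]]
      action_inv[OF S] action_inv[OF T] using lim by blast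
  then show ?thesis
    using S T unfolding action_topology_def limitin_subtopology limitin_componentwise
    by (auto simp: PiE_iff topspace_weak_topology action_carrier)
qed

lemma finite_cube_abs: "finite {\<gamma> :: int ^ 'n::finite. \<forall>i. \<bar>\<gamma> $ i\<bar> \<le> R}"
proof (rule finite_subset[OF _ finite_cube[of "- R" "R + 1"]], safe)
  fix \<gamma> :: "int ^ 'n" assume le: "\<forall>i. \<bar>\<gamma> $ i\<bar> \<le> R"
  have "- R \<le> \<gamma> $ i \<and> \<gamma> $ i < R + 1" for i using spec[OF le, of i] by linarith
  then show "\<gamma> \<in> cube (- R) (R + 1)" by (simp add: cube_def)
qed

theorem theorem5p6:
  fixes M :: "'a measure"
  assumes "CARD('n::finite) \<ge> 2"
    and "standard_borel M" and "sigma_finite_measure M" and "nonatomic M"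
    and "emeasure M (space M) = \<infinity>"
  shows "residual_in (action_topology M)
           {T \<in> (actions M :: (int ^ 'n \<Rightarrow> ('a \<Rightarrow> 'a) set) set). recurrent_lines M T = lines}"
proof -
  let ?one = "\<one>\<^bsub>aut_group M\<^esub>"
  obtain A :: "nat \<Rightarrow> 'a set" where A: "\<And>i. A i \<in> sets M" "\<And>i. emeasure M (A i) \<noteq> \<infinity>"
    "\<And>C e. C \<in> sets M \<Longrightarrow> emeasure M C \<noteq> \<infinity> \<Longrightarrow> 0 < e \<Longrightarrow> \<exists>i. emeasure M (sym_diff C (A i)) < ennreal e"
    using countable_dense_sets[OF assms(2,3)] by blast
  obtain X :: "nat \<Rightarrow> 'a set" where X: "range X \<subseteq> sets M" "(\<Union>i. X i) = space M" "\<And>i. emeasure M (X i) \<noteq> \<infinity>"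
    using sigma_finite_measure.sigma_finite_incseq[OF assms(3)] by metis
  have Xs: "X n \<in> sets M" for n using X(1) by blast
  \<comment> \<open>Distances between sets are controlled only for finite measure; this supplies the
    non-null set \<open>A0\<close> and later cuts an arbitrary set of positive measure down to
    finite measure.\<close>
  have finite_part: "\<exists>C'. C' \<in> sets M \<and> C' \<subseteq> C \<and> emeasure M C' \<noteq> 0 \<and> emeasure M C' \<noteq> \<infinity>"
    if C: "C \<in> sets M" "emeasure M C \<noteq> 0" for C
  proof -
    have "\<exists>n. emeasure M (C \<inter> X n) \<noteq> 0"
    proof (rule ccontr)
      assume "\<nexists>n. emeasure M (C \<inter> X n) \<noteq> 0"
      then have "C \<inter> X n \<in> null_sets M" for n using C(1) Xs by (auto simp: null_sets_def)
      then have "(\<Union>n. C \<inter> X n) \<in> null_sets M" by (intro null_sets_UN) auto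
      moreover have "(\<Union>n. C \<inter> X n) = C" using X(2) sets.sets_into_space[OF C(1)] by blast
      ultimately show False using C(2) by (simp add: null_sets_def)
    qed
    then obtain n where n: "emeasure M (C \<inter> X n) \<noteq> 0" by blast
    have "emeasure M (C \<inter> X n) \<le> emeasure M (X n)" using Xs by (intro emeasure_mono) auto
    then have "emeasure M (C \<inter> X n) \<noteq> \<infinity>" using X(3)[of n] by (metis infinity_ennreal_def top_unique)
    with n C(1) Xs show ?thesis by (intro exI[of _ "C \<inter> X n"]) auto
  qed
  obtain A0 where A0: "A0 \<in> sets M" "emeasure M A0 \<noteq> 0" "emeasure M A0 \<noteq> \<infinity>"
    using finite_part[of "space M"] assms(5) by auto
  have "\<exists>R :: int. \<forall>\<theta> :: (real ^ 'n) set. \<theta> \<in> lines \<longrightarrow> (\<exists>\<gamma>. \<gamma> \<noteq> 0 \<and> (\<forall>i. \<bar>\<gamma> $ i\<bar> \<le> R) \<and>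
      (\<exists>g\<in>\<theta>. dist (lattice_point (\<chi> i. int N * \<gamma> $ i)) g < 1 / Suc k))" for N k :: nat
    by (rule dirichlet_line[of "1 / Suc k" N]) auto
  then obtain R :: "nat \<Rightarrow> nat \<Rightarrow> int" where R: "\<And>N k \<theta>. \<theta> \<in> (lines :: (real ^ 'n) set set) \<Longrightarrow>
      \<exists>\<gamma>. \<gamma> \<noteq> 0 \<and> (\<forall>i. \<bar>\<gamma> $ i\<bar> \<le> R N k) \<and>
      (\<exists>g\<in>\<theta>. dist (lattice_point (\<chi> i. int N * \<gamma> $ i)) g < 1 / Suc k)"
    by metis
  define box where "box r = {\<gamma> :: int ^ 'n. \<forall>i. \<bar>\<gamma> $ i\<bar> \<le> r}" for r
  have finite_box: "finite (box r)" for r unfolding box_def by (rule finite_cube_abs)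
  define near where "near k v i = {T \<in> (actions M :: (int ^ 'n \<Rightarrow> ('a \<Rightarrow> 'a) set) set).
    emeasure M (sym_diff (aut_image M (T v) (A i)) (aut_image M ?one (A i))) < ennreal (1 / Suc k)}" for k v i
  \<comment> \<open>The union over \<open>N\<close> may be infinite, but for fixed \<open>N\<close>
    and \<open>k\<close> the box and the indices up to \<open>k\<close> are finite, so the
    intersection of balls is open. The factor \<open>actions M\<close> keeps it inside the space
    whatever the index set.\<close>
  define V where "V k = (\<Union>N\<in>{0<..}. (\<Inter>p\<in>box (R N k) \<times> {..k}. near k (\<chi> i. int N * fst p $ i) (snd p)) \<inter> actions M)" for k
  define G where "G = (\<Inter>k. V k)"
  have one: "?one \<in> carrier (aut_group M)"
    using group.is_monoid[OF group_aut_group, THEN monoid.one_closed] .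
  have open_near: "openin (action_topology M) (near k v i)" for k v i
    unfolding near_def using A(1,2)[of i] by (intro openin_action_ball one) (auto simp: less_top)
  have open_V: "openin (action_topology M) (V k)" for k
    unfolding V_def
  proof (intro openin_Union ballI, safe)
    fix N
    have "openin (action_topology M) (\<Inter> ((\<lambda>p. near k (\<chi> i. int N * fst p $ i) (snd p)) ` (box (R N k) \<times> {..k}) \<union> {actions M}))"
      using open_near finite_box openin_topspace[of "action_topology M"]
      by (intro openin_Inter) (auto simp: topspace_action_topology)
    then show "openin (action_topology M) ((\<Inter>p\<in>box (R N k) \<times> {..k}. near k (\<chi> i. int N * fst p $ i) (snd p)) \<inter> actions M)"
      by (simp add: Int_commute)
  qed
  have gdelta: "gdelta_in (action_topology M) G"
    unfolding gdelta_in_alt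
  proof
    show "G \<subseteq> topspace (action_topology M)" unfolding topspace_action_topology G_def V_def by blast
    show "(countable intersection_of openin (action_topology M)) G"
      unfolding intersection_of_def G_def using open_V by (intro exI[of _ "range V"]) auto
  qed
  have periodic_G: "T \<in> G"
    if T: "T \<in> actions M" "N > 0" "\<And>v. T (\<chi> i. int N * v $ i) = ?one" for T and N :: nat
  proof -
    \<comment> \<open>At multiples of the period the compared images are literally equal, so one
      \<open>N\<close> serves every \<open>k\<close>.\<close>
    have "T \<in> near k (\<chi> i. int N * v $ i) i" for k v i
      unfolding near_def using T(1) T(3)[of v] by simp
    then show ?thesis unfolding G_def V_def using T(1,2) by blast
  qed
  show ?thesis
    unfolding residual_in_def
  proof (intro conjI exI[of _ G])
    show "{T \<in> (actions M :: (int ^ 'n \<Rightarrow> ('a \<Rightarrow> 'a) set) set). recurrent_lines M T = lines}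
        \<subseteq> topspace (action_topology M)"
      unfolding topspace_action_topology by blast
    show "gdelta_in (action_topology M) G" by (rule gdelta)
    show "(action_topology M) closure_of G = topspace (action_topology M)"
    proof (rule antisym[OF closure_of_subset_topspace], rule subsetI)
      fix T assume "T \<in> topspace (action_topology M :: (int ^ 'n \<Rightarrow> ('a \<Rightarrow> 'a) set) topology)"
      then have T: "T \<in> actions M" by (simp add: topspace_action_topology)
      \<comment> \<open>Number of sets, size of the box and tolerance all improve with
        \<open>n\<close>, so each fixed vector and each fixed member of the dense family is
        eventually controlled.\<close>
      have "\<exists>S. S \<in> G \<and> S \<in> actions M \<and> (\<forall>i\<le>n. \<forall>\<gamma>\<in>box (int n).
          emeasure M (sym_diff (aut_image M (S \<gamma>) (A i)) (aut_image M (T \<gamma>) (A i))) < ennreal (1 / Suc n))" for n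
      proof (rule periodic_approximation[OF assms(2,4) T A0, of "A ` {..n}" "box (int n)" "1 / Suc n"])
        fix T' N
        assume T': "T' \<in> actions M" "N > 0" "\<And>v. T' (\<chi> i. int N * v $ i) = ?one"
          "\<And>C \<gamma>. C \<in> A ` {..n} \<Longrightarrow> \<gamma> \<in> box (int n) \<Longrightarrow>
            emeasure M (sym_diff (aut_image M (T' \<gamma>) C) (aut_image M (T \<gamma>) C)) < ennreal (1 / Suc n)"
        then show ?thesis using periodic_G by (intro exI[of _ T']) blast
      qed (use A finite_box in auto)
      then obtain S where S: "\<And>n. S n \<in> G" "\<And>n. S n \<in> actions M"
        "\<And>n i \<gamma>. i \<le> n \<Longrightarrow> \<gamma> \<in> box (int n) \<Longrightarrow>
          emeasure M (sym_diff (aut_image M (S n \<gamma>) (A i)) (aut_image M (T \<gamma>) (A i))) < ennreal (1 / Suc n)"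
        by metis
      have "limitin (action_topology M) S T sequentially"
      proof (rule limitin_action_topology[OF S(2) T])
        fix v C assume C: "C \<in> sets M" "emeasure M C < \<infinity>"
        show "(\<lambda>n. emeasure M (sym_diff (aut_image M (S n v) C) (aut_image M (T v) C))) \<longlonglongrightarrow> 0"
        proof (rule order_tendstoI)
          fix a :: ennreal assume "0 < a"
          then obtain y where y: "0 < y" "y < a" using dense by blast
          then obtain e where e: "y = ennreal e" "0 < e"
            by (cases y) (auto simp: ennreal_less_zero_iff)
          obtain i where i: "emeasure M (sym_diff C (A i)) < ennreal (e / 3)"
            using A(3)[OF C(1), of "e / 3"] C(2) e(2) by (auto simp: less_top)
          obtain n0 where n0: "1 / Suc n0 < e / 3" using e(2) nat_approx_posE[of "e / 3"] by auto
          define K where "K = nat (Max (range (\<lambda>j. \<bar>v $ j\<bar>)))"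
          have K: "\<bar>v $ j\<bar> \<le> int K" for j
          proof -
            have "\<bar>v $ j\<bar> \<le> Max (range (\<lambda>j. \<bar>v $ j\<bar>))" by (intro Max_ge) auto
            then show ?thesis unfolding K_def by linarith
          qed
          \<comment> \<open>Past this threshold \<open>A i\<close> is among the tracked sets, the
            tolerance is below \<open>e / 3\<close> and \<open>v\<close> lies in the box. Passing
            between the two images of \<open>C\<close> through those of \<open>A i\<close> then
            costs three times \<open>e / 3\<close>.\<close>
          have "emeasure M (sym_diff (aut_image M (S n v) C) (aut_image M (T v) C)) < a"
            if n: "n \<ge> max (max i n0) K" for n
          proof -
            let ?SC = "aut_image M (S n v) C" and ?TC = "aut_image M (T v) C"
            let ?SA = "aut_image M (S n v) (A i)" and ?TA = "aut_image M (T v) (A i)"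
            note sets = aut_image_sets[OF action_carrier[OF S(2)] C(1)] aut_image_sets[OF action_carrier[OF T] C(1)]
              aut_image_sets[OF action_carrier[OF S(2)] A(1)] aut_image_sets[OF action_carrier[OF T] A(1)]
            have n': "i \<le> n" "n0 \<le> n" "int K \<le> int n" using n by auto
            have "v \<in> box (int n)" using order_trans[OF K n'(3)] by (simp add: box_def)
            then have close: "emeasure M (sym_diff ?SA ?TA) < ennreal (1 / Suc n)" by (rule S(3)[OF n'(1)])
            have "1 / real (Suc n) \<le> 1 / Suc n0" using n'(2) by (intro divide_left_mono) auto
            then have "ennreal (1 / Suc n) \<le> ennreal (e / 3)" using n0 by (intro ennreal_leI) linarith
            then have 2: "emeasure M (sym_diff ?SA ?TA) \<le> ennreal (e / 3)" using close by (meson less_imp_le order_trans)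
            have 1: "emeasure M (sym_diff ?SC ?SA) \<le> ennreal (e / 3)"
              using i emeasure_sym_diff_aut_image[OF action_carrier[OF S(2)] C(1) A(1)] by (simp add: less_imp_le)
            have "sym_diff (A i) C = sym_diff C (A i)" by blast
            then have 3: "emeasure M (sym_diff ?TA ?TC) \<le> ennreal (e / 3)"
              using i emeasure_sym_diff_aut_image[OF action_carrier[OF T] A(1) C(1)] by (simp add: less_imp_le)
            have "emeasure M (sym_diff ?SC ?TC) \<le> emeasure M (sym_diff ?SC ?SA) + emeasure M (sym_diff ?SA ?TC)"
              by (rule emeasure_sym_diff_triangle) (rule sets)+
            also have "\<dots> \<le> emeasure M (sym_diff ?SC ?SA) + (emeasure M (sym_diff ?SA ?TA) + emeasure M (sym_diff ?TA ?TC))"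
              by (intro add_left_mono emeasure_sym_diff_triangle) (rule sets)+
            also have "\<dots> \<le> ennreal (e / 3) + (ennreal (e / 3) + ennreal (e / 3))"
              by (intro add_mono 1 2 3)
            also have "\<dots> = y" using e by (simp add: ennreal_plus[symmetric] del: ennreal_plus)
            also have "\<dots> < a" by (rule y(2))
            finally show ?thesis .
          qed
          then show "\<forall>\<^sub>F n in sequentially. emeasure M (sym_diff (aut_image M (S n v) C) (aut_image M (T v) C)) < a"
            unfolding eventually_sequentially by blast
        qed simp
      qed
      then have "\<exists>n. S n \<in> W" if "T \<in> W" "openin (action_topology M) W" for W
        using that unfolding limitin_def by (meson eventually_happens trivial_limit_sequentially)
      then show "T \<in> (action_topology M) closure_of G"
        using S(1) T unfolding in_closure_of topspace_action_topology by blast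
    qed
    show "G \<subseteq> {T \<in> actions M. recurrent_lines M T = lines}"
    proof (intro subsetI CollectI conjI)
      fix T assume TG: "T \<in> G"
      then show T: "T \<in> actions M" by (auto simp: G_def V_def)
      have "recurrent_along M T \<theta>" if \<theta>: "\<theta> \<in> lines" for \<theta>
        unfolding recurrent_along_def
      proof (intro allI impI ballI)
        fix e :: real and C assume "e > 0" and C: "C \<in> sets M" "0 < emeasure M C"
        obtain D where D: "D \<in> sets M" "D \<subseteq> C" "emeasure M D \<noteq> 0" "emeasure M D \<noteq> \<infinity>"
          using finite_part[OF C(1)] C(2) by (metis less_irrefl)
        define c where "c = measure M D"
        have c: "emeasure M D = ennreal c" "c > 0"
        proof -
          show "emeasure M D = ennreal c" using D(4) by (simp add: c_def emeasure_eq_ennreal_measure)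
          then show "c > 0" using D(3) by (metis ennreal_eq_0_iff not_less)
        qed
        \<comment> \<open>The chain from \<open>D\<close> to its image runs through
          \<open>A i\<close>, the image of \<open>A i\<close> under the unit class and the image of
          \<open>A i\<close> under \<open>T v\<close>. Three links cost at most \<open>c / 4\<close>
          and one costs nothing: \<open>3 * c / 4\<close> in all, less than the measure
          \<open>c\<close> of \<open>D\<close>.\<close>
        obtain i where i: "emeasure M (sym_diff D (A i)) < ennreal (c / 4)"
          using A(3)[OF D(1,4), of "c / 4"] c(2) by (metis divide_pos_pos zero_less_numeral)
        obtain k0 where k0: "1 / Suc k0 < min e (c / 4)"
          by (rule nat_approx_posE[of "min e (c / 4)"]) (use \<open>e > 0\<close> c(2) in auto)
        \<comment> \<open>One index has to do two things: \<open>i \<le> k\<close> puts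
          \<open>A i\<close> among the sets controlled by \<open>V k\<close>, and
          \<open>k0 \<le> k\<close> makes \<open>1 / Suc k\<close> small against both the distance
          \<open>e\<close> and the measure \<open>c / 4\<close>.\<close>
        define k where "k = max i k0"
        have "1 / real (Suc k) \<le> 1 / Suc k0" by (intro divide_left_mono) (auto simp: k_def)
        then have k: "1 / Suc k < e" "1 / Suc k < c / 4" using k0 by auto
        have "T \<in> V k" using TG by (auto simp: G_def)
        then obtain N where N: "N > 0" "\<And>\<gamma> j. \<gamma> \<in> box (R N k) \<Longrightarrow> j \<le> k \<Longrightarrow> T \<in> near k (\<chi> i. int N * \<gamma> $ i) j"
          unfolding V_def by auto
        obtain \<gamma> g where \<gamma>: "\<gamma> \<noteq> 0" "\<gamma> \<in> box (R N k)" "g \<in> \<theta>"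
          "dist (lattice_point (\<chi> i. int N * \<gamma> $ i)) g < 1 / Suc k"
          using R[OF \<theta>, of N k] by (auto simp: box_def)
        define v where "v = (\<chi> i. int N * \<gamma> $ i)"
        have "v \<noteq> 0" using \<gamma>(1) N(1) by (auto simp: v_def vec_eq_iff)
        have "dist (lattice_point v) g < e" using \<gamma>(4) k(1) by (simp add: v_def)
        let ?TD = "aut_image M (T v) D" and ?TA = "aut_image M (T v) (A i)" and ?A = "aut_image M ?one (A i)"
        note sets = D(1) A(1)[of i] aut_image_sets[OF action_carrier[OF T] D(1)]
          aut_image_sets[OF action_carrier[OF T] A(1)] aut_image_sets[OF one A(1)]
        have 1: "emeasure M (sym_diff D (A i)) \<le> ennreal (c / 4)" using i by simp
        have "sym_diff (A i) ?A = sym_diff ?A (A i)" by blast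
        then have 2: "emeasure M (sym_diff (A i) ?A) = 0"
          using emeasure_aut_image_one_sym_diff[OF A(1)] by metis
        have "T \<in> near k v i" unfolding v_def by (rule N(2)[OF \<gamma>(2)]) (simp add: k_def)
        then have "emeasure M (sym_diff ?TA ?A) < ennreal (1 / Suc k)" unfolding near_def by blast
        also have "\<dots> \<le> ennreal (c / 4)" using k(2) by (intro ennreal_leI less_imp_le)
        finally have "emeasure M (sym_diff ?TA ?A) \<le> ennreal (c / 4)" by (rule less_imp_le)
        moreover have "sym_diff ?A ?TA = sym_diff ?TA ?A" by blast
        ultimately have 3: "emeasure M (sym_diff ?A ?TA) \<le> ennreal (c / 4)" by (simp only:)
        have "sym_diff (A i) D = sym_diff D (A i)" by blast
        then have 4: "emeasure M (sym_diff ?TA ?TD) \<le> ennreal (c / 4)"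
          using 1 emeasure_sym_diff_aut_image[OF action_carrier[OF T] A(1) D(1)] by simp
        have "emeasure M (sym_diff D ?TD) \<le> emeasure M (sym_diff D (A i)) + emeasure M (sym_diff (A i) ?TD)"
          by (rule emeasure_sym_diff_triangle) (rule sets)+
        also have "\<dots> \<le> emeasure M (sym_diff D (A i)) + (emeasure M (sym_diff (A i) ?A) + emeasure M (sym_diff ?A ?TD))"
          by (intro add_left_mono emeasure_sym_diff_triangle) (rule sets)+
        also have "\<dots> \<le> emeasure M (sym_diff D (A i)) + (emeasure M (sym_diff (A i) ?A) +
            (emeasure M (sym_diff ?A ?TA) + emeasure M (sym_diff ?TA ?TD)))"
          by (intro add_left_mono emeasure_sym_diff_triangle) (rule sets)+
        also have "\<dots> \<le> ennreal (c / 4) + (0 + (ennreal (c / 4) + ennreal (c / 4)))"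
          unfolding 2 by (intro add_mono 1 3 4 order_refl)
        also have "\<dots> = ennreal (3 * c / 4)" using c(2) by (simp add: ennreal_plus[symmetric] del: ennreal_plus)
        also have "\<dots> < emeasure M D" unfolding c(1) using c(2) by (intro ennreal_lessI) auto
        finally have small: "emeasure M (sym_diff D ?TD) < emeasure M D" .
        \<comment> \<open>\<open>D\<close> is covered by its intersection with the image and by the
          symmetric difference, which is too small to cover \<open>D\<close> alone.\<close>
        have "emeasure M (D \<inter> ?TD) \<noteq> 0"
        proof
          assume null: "emeasure M (D \<inter> ?TD) = 0"
          have "emeasure M D \<le> emeasure M ((D \<inter> ?TD) \<union> sym_diff D ?TD)"
            using sets by (intro emeasure_mono) auto
          also have "\<dots> \<le> emeasure M (D \<inter> ?TD) + emeasure M (sym_diff D ?TD)"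
            using sets by (intro emeasure_subadditive) auto
          finally show False using small null by simp
        qed
        moreover have "D \<inter> ?TD \<subseteq> C \<inter> aut_image M (T v) C"
          using D(2) unfolding aut_image_def by blast
        then have "emeasure M (D \<inter> ?TD) \<le> emeasure M (C \<inter> aut_image M (T v) C)"
          using aut_image_sets[OF action_carrier[OF T] C(1)] C(1) by (intro emeasure_mono) auto
        ultimately have "0 < emeasure M (C \<inter> aut_image M (T v) C)"
          by (metis le_zero_eq zero_less_iff_neq_zero)
        then show "\<exists>\<gamma>. \<gamma> \<noteq> 0 \<and> (\<exists>g\<in>\<theta>. dist (lattice_point \<gamma>) g < e) \<and> 0 < emeasure M (C \<inter> aut_image M (T \<gamma>) C)"
          using \<open>v \<noteq> 0\<close> \<open>dist (lattice_point v) g < e\<close> \<gamma>(3) by blast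
      qed
      then show "recurrent_lines M T = lines" unfolding recurrent_lines_def by blast
    qed
  qed
qed

end
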